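(* Let $\Bbbk$ be a field of characteristic $0$. Let $A$ be the Hopf algebra generated by $g,h$ subject to $g^2=1$, $gh=-hg$, with $g$ group-like and $\Delta(h)=g\otimes h+h\otimes1$, let $\mathcal C$ be the full subcategory of finite dimensional left $A$-modules on which $h^2$ acts by a semisimple (diagonalizable) linear operator with integer eigenvalues, and let $H$ be the Hopf algebra reconstructed from $\mathcal C$ and its forgetful functor to vector spaces. Then $H$ is presented by generators $u,x,a^{\pm1}$ and defining relations $$u^2=1,\quad x^2=0,\quad ux=-xu,\quad a^{\pm1}a^{\mp1}=1,\quad ua=au,\quad ax=xa.$$ Its comultiplication, counit and antipode are given by $$\Delta(u)=u\otimes u,\quad \Delta(x)=u\otimes x+x\otimes1,\quad \Delta(a^{\pm1})=a^{\pm1}\otimes a^{\pm1}\pm xua^{\pm1}\otimes xa^{\pm1},$$ $$\varepsilon(u)=1,\quad\varepsilon(x)=0,\quad\varepsilon(a^{\pm1})=1,\qquad \mathcal S(u)=u,\quad \mathcal S(x)=xu,\quad \mathcal S(a^{\pm1})=a^{\mp1}.$$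
   Context: Concretely, $H$ is the Hopf subalgebra $H=\sum_{X\in\mathcal C}cf(X)$ of the finite dual Hopf algebra $A^0$, where $cf(X)\subset A^0$ is the space of matrix coefficients of the $A$-module $X$. Every $X\in\mathcal C$ is naturally a finite dimensional right $H$-comodule, and $\mathcal C$ is tensor equivalent to the category of finite dimensional right $H$-comodules. The product and coproduct of $A^0$ are dual to the coproduct and product of $A$: $\langle fe,y\rangle=\langle f,y_{(1)}\rangle\langle e,y_{(2)}\rangle$ and $\langle\Delta(f),y\otimes z\rangle=\langle f,yz\rangle$. *)

theory Defs
  imports
    "HOL-Library.Poly_Mapping"
    "HOL-Library.Function_Algebras"
    "Jordan_Normal_Form.Char_Poly"
begin

section \<open>Free vector spaces, free algebras and presentations\<close>

text \<open>
  The free vector space on a type \<open>'x\<close> is the type of finitely supported functions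
  \<open>'x \<Rightarrow>\<^sub>0 'k\<close>, with basis vectors \<open>Poly_Mapping.single i 1\<close>.
\<close>

definition free_scale :: "'k::field \<Rightarrow> ('x \<Rightarrow>\<^sub>0 'k) \<Rightarrow> ('x \<Rightarrow>\<^sub>0 'k)" where
  "free_scale c = Poly_Mapping.map ((*) c)"

lemma lookup_free_scale [simp]:
  "Poly_Mapping.lookup (free_scale c t) i = c * Poly_Mapping.lookup t i"
  by (simp add: free_scale_def Poly_Mapping.map.rep_eq when_def)

global_interpretation free: vector_space "free_scale :: 'k::field \<Rightarrow> ('x \<Rightarrow>\<^sub>0 'k) \<Rightarrow> ('x \<Rightarrow>\<^sub>0 'k)"
  by standard (auto intro!: poly_mapping_eqI simp: lookup_add algebra_simps)

definition linear_ext ::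
    "('k::field \<Rightarrow> 'b::ab_group_add \<Rightarrow> 'b) \<Rightarrow> ('x \<Rightarrow> 'b) \<Rightarrow> ('x \<Rightarrow>\<^sub>0 'k) \<Rightarrow> 'b" where
  "linear_ext scale f t = (\<Sum>i\<in>Poly_Mapping.keys t. scale (Poly_Mapping.lookup t i) (f i))"

text \<open>
  Words form the free monoid, written additively because the convolution product of
  \<open>HOL-Library.Poly_Mapping\<close> expects an additive monoid of exponents; hence
  \<open>'x free_monoid \<Rightarrow>\<^sub>0 'k\<close> with its library ring structure is the free associative unital
  algebra on \<open>'x\<close>.
\<close>

datatype 'x free_monoid = Word (letters: "'x list")

instantiation free_monoid :: (type) monoid_add
begin

definition zero_free_monoid :: "'a free_monoid" where
  "0 = Word []"

definition plus_free_monoid :: "'a free_monoid \<Rightarrow> 'a free_monoid \<Rightarrow> 'a free_monoid" where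
  "v + w = Word (letters v @ letters w)"

instance
  by standard (simp_all add: zero_free_monoid_def plus_free_monoid_def)

end

definition var :: "'x \<Rightarrow> 'x free_monoid \<Rightarrow>\<^sub>0 'k::field" where
  "var i = Poly_Mapping.single (Word [i]) 1"

definition two_sided_ideal :: "'r::ring_1 set \<Rightarrow> bool" where
  "two_sided_ideal I \<longleftrightarrow>
     0 \<in> I \<and> (\<forall>p\<in>I. \<forall>q\<in>I. p + q \<in> I) \<and> (\<forall>p\<in>I. \<forall>r. r * p \<in> I \<and> p * r \<in> I)"

definition ideal_generated :: "'r::ring_1 set \<Rightarrow> 'r set" where
  "ideal_generated R = \<Inter>{I. two_sided_ideal I \<and> R \<subseteq> I}"

definition eval_free ::
    "('k::field \<Rightarrow> 'b::ab_group_add \<Rightarrow> 'b) \<Rightarrow> ('b \<Rightarrow> 'b \<Rightarrow> 'b) \<Rightarrow> 'b \<Rightarrow> ('x \<Rightarrow> 'b)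
      \<Rightarrow> ('x free_monoid \<Rightarrow>\<^sub>0 'k) \<Rightarrow> 'b" where
  "eval_free scale mul unity gen =
     linear_ext scale (\<lambda>w. foldr (\<lambda>i. mul (gen i)) (letters w) unity)"

text \<open>
  The algebra with carrier \<open>V\<close> is the free algebra on \<open>'x\<close> modulo the two-sided ideal
  generated by \<open>rels\<close>, the variable \<open>i\<close> corresponding to \<open>gen i\<close>.
\<close>

definition presented_by ::
    "('k::field \<Rightarrow> 'b::ab_group_add \<Rightarrow> 'b) \<Rightarrow> 'b set \<Rightarrow> ('b \<Rightarrow> 'b \<Rightarrow> 'b) \<Rightarrow> 'b \<Rightarrow> ('x \<Rightarrow> 'b)
      \<Rightarrow> ('x free_monoid \<Rightarrow>\<^sub>0 'k) set \<Rightarrow> bool" where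
  "presented_by scale V mul unity gen rels \<longleftrightarrow>
     range gen \<subseteq> V \<and>
     range (eval_free scale mul unity gen) = V \<and>
     {p. eval_free scale mul unity gen p = 0} = ideal_generated rels"


section \<open>Tensor products\<close>

text \<open>
  Elements of \<open>V \<otimes> V\<close> are cosets of formal sums of pairs from \<open>V\<close> modulo the bilinearity
  relations.  A formal sum \<open>t\<close> represents the tensor \<open>T\<close> iff \<open>t \<in> T\<close>.
\<close>

definition formal_tensors :: "'b set \<Rightarrow> ('b \<times> 'b \<Rightarrow>\<^sub>0 'k::field) set" where
  "formal_tensors V = {t. Poly_Mapping.keys t \<subseteq> V \<times> V}"

definition pure_tensor :: "'b \<Rightarrow> 'b \<Rightarrow> ('b \<times> 'b \<Rightarrow>\<^sub>0 'k::field)" (infix \<open>\<otimes>\<^sub>f\<close> 68) where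
  "v \<otimes>\<^sub>f w = Poly_Mapping.single (v, w) 1"

text \<open>Relations that make \<open>v \<mapsto> slot v\<close> linear on \<open>V\<close>.\<close>

definition slot_rels ::
    "('k::field \<Rightarrow> 'b::ab_group_add \<Rightarrow> 'b) \<Rightarrow> 'b set \<Rightarrow> ('b \<Rightarrow> 'x) \<Rightarrow> ('x \<Rightarrow>\<^sub>0 'k) set" where
  "slot_rels scale V slot =
     {Poly_Mapping.single (slot (v + w)) 1 - Poly_Mapping.single (slot v) 1
        - Poly_Mapping.single (slot w) 1 | v w. v \<in> V \<and> w \<in> V} \<union>
     {Poly_Mapping.single (slot (scale c v)) 1 - Poly_Mapping.single (slot v) c | c v. v \<in> V}"

definition tensor2_null ::
    "('k::field \<Rightarrow> 'b::ab_group_add \<Rightarrow> 'b) \<Rightarrow> 'b set \<Rightarrow> ('b \<times> 'b \<Rightarrow>\<^sub>0 'k) set" where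
  "tensor2_null scale V = free.span
     (\<Union>w\<in>V. slot_rels scale V (\<lambda>v. (v, w)) \<union> slot_rels scale V (\<lambda>v. (w, v)))"

definition tensor3_null ::
    "('k::field \<Rightarrow> 'b::ab_group_add \<Rightarrow> 'b) \<Rightarrow> 'b set \<Rightarrow> ('b \<times> 'b \<times> 'b \<Rightarrow>\<^sub>0 'k) set" where
  "tensor3_null scale V = free.span
     (\<Union>w\<in>V. \<Union>z\<in>V. slot_rels scale V (\<lambda>v. (v, w, z)) \<union> slot_rels scale V (\<lambda>v. (w, v, z))
        \<union> slot_rels scale V (\<lambda>v. (w, z, v)))"

definition tensor_class ::
    "('k::field \<Rightarrow> 'b::ab_group_add \<Rightarrow> 'b) \<Rightarrow> 'b set \<Rightarrow> ('b \<times> 'b \<Rightarrow>\<^sub>0 'k)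
      \<Rightarrow> ('b \<times> 'b \<Rightarrow>\<^sub>0 'k) set" where
  "tensor_class scale V t = {s \<in> formal_tensors V. s - t \<in> tensor2_null scale V}"

definition tensor_square ::
    "('k::field \<Rightarrow> 'b::ab_group_add \<Rightarrow> 'b) \<Rightarrow> 'b set \<Rightarrow> ('b \<times> 'b \<Rightarrow>\<^sub>0 'k) set set" where
  "tensor_square scale V = tensor_class scale V ` formal_tensors V"

definition tensor_mult ::
    "('b \<Rightarrow> 'b \<Rightarrow> 'b) \<Rightarrow> ('b \<times> 'b \<Rightarrow>\<^sub>0 'k::field) \<Rightarrow> ('b \<times> 'b \<Rightarrow>\<^sub>0 'k) \<Rightarrow> ('b \<times> 'b \<Rightarrow>\<^sub>0 'k)" where
  "tensor_mult mul s t =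
     linear_ext free_scale (\<lambda>(p, q). linear_ext free_scale (\<lambda>(p', q'). mul p p' \<otimes>\<^sub>f mul q q') t) s"


section \<open>Hopf algebras\<close>

text \<open>
  The underlying space is a subspace \<open>V\<close> of an ambient vector space.  Axioms about \<open>\<Delta>\<close> are
  expressed through arbitrary representatives of its values; for instance \<open>comult_mult\<close> says
  \<open>\<Delta>(y z) = \<Delta>(y) \<Delta>(z)\<close> in the algebra \<open>V \<otimes> V\<close>.
\<close>

locale hopf_algebra = vector_space scale
  for scale :: "'k::field \<Rightarrow> 'b::ab_group_add \<Rightarrow> 'b" +
  fixes V :: "'b set"
    and mul :: "'b \<Rightarrow> 'b \<Rightarrow> 'b"
    and unity :: 'b
    and \<Delta> :: "'b \<Rightarrow> ('b \<times> 'b \<Rightarrow>\<^sub>0 'k) set"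
    and \<epsilon> :: "'b \<Rightarrow> 'k"
    and S :: "'b \<Rightarrow> 'b"
  assumes subspace_V: "subspace V"
    and mult_closed: "\<lbrakk>y \<in> V; z \<in> V\<rbrakk> \<Longrightarrow> mul y z \<in> V"
    and mult_assoc: "\<lbrakk>y \<in> V; z \<in> V; w \<in> V\<rbrakk> \<Longrightarrow> mul (mul y z) w = mul y (mul z w)"
    and mult_add_left: "\<lbrakk>y \<in> V; z \<in> V; w \<in> V\<rbrakk> \<Longrightarrow> mul (y + z) w = mul y w + mul z w"
    and mult_add_right: "\<lbrakk>y \<in> V; z \<in> V; w \<in> V\<rbrakk> \<Longrightarrow> mul y (z + w) = mul y z + mul y w"
    and mult_scale_left: "\<lbrakk>y \<in> V; z \<in> V\<rbrakk> \<Longrightarrow> mul (scale c y) z = scale c (mul y z)"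
    and mult_scale_right: "\<lbrakk>y \<in> V; z \<in> V\<rbrakk> \<Longrightarrow> mul y (scale c z) = scale c (mul y z)"
    and one_closed: "unity \<in> V"
    and one_left: "y \<in> V \<Longrightarrow> mul unity y = y"
    and one_right: "y \<in> V \<Longrightarrow> mul y unity = y"
    and comult_closed: "y \<in> V \<Longrightarrow> \<Delta> y \<in> tensor_square scale V"
    and comult_add: "\<lbrakk>y \<in> V; z \<in> V; s \<in> \<Delta> y; t \<in> \<Delta> z\<rbrakk> \<Longrightarrow> s + t \<in> \<Delta> (y + z)"
    and comult_scale: "\<lbrakk>y \<in> V; t \<in> \<Delta> y\<rbrakk> \<Longrightarrow> free_scale c t \<in> \<Delta> (scale c y)"
    and comult_mult:
      "\<lbrakk>y \<in> V; z \<in> V; s \<in> \<Delta> y; t \<in> \<Delta> z\<rbrakk> \<Longrightarrow> tensor_mult mul s t \<in> \<Delta> (mul y z)"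
    and comult_one: "unity \<otimes>\<^sub>f unity \<in> \<Delta> unity"
    and coassoc:
      "\<lbrakk>y \<in> V; t \<in> \<Delta> y; \<And>p. p \<in> V \<Longrightarrow> D p \<in> \<Delta> p\<rbrakk> \<Longrightarrow>
         linear_ext free_scale (\<lambda>(p, q).
             linear_ext free_scale (\<lambda>(p1, p2). Poly_Mapping.single (p1, p2, q) 1) (D p)) t
         - linear_ext free_scale (\<lambda>(p, q).
             linear_ext free_scale (\<lambda>(q1, q2). Poly_Mapping.single (p, q1, q2) 1) (D q)) t
         \<in> tensor3_null scale V"
    and counit_add: "\<lbrakk>y \<in> V; z \<in> V\<rbrakk> \<Longrightarrow> \<epsilon> (y + z) = \<epsilon> y + \<epsilon> z"
    and counit_scale: "y \<in> V \<Longrightarrow> \<epsilon> (scale c y) = c * \<epsilon> y"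
    and counit_mult: "\<lbrakk>y \<in> V; z \<in> V\<rbrakk> \<Longrightarrow> \<epsilon> (mul y z) = \<epsilon> y * \<epsilon> z"
    and counit_one: "\<epsilon> unity = 1"
    and counit_left: "\<lbrakk>y \<in> V; t \<in> \<Delta> y\<rbrakk> \<Longrightarrow> linear_ext scale (\<lambda>(p, q). scale (\<epsilon> p) q) t = y"
    and counit_right: "\<lbrakk>y \<in> V; t \<in> \<Delta> y\<rbrakk> \<Longrightarrow> linear_ext scale (\<lambda>(p, q). scale (\<epsilon> q) p) t = y"
    and antipode_closed: "y \<in> V \<Longrightarrow> S y \<in> V"
    and antipode_add: "\<lbrakk>y \<in> V; z \<in> V\<rbrakk> \<Longrightarrow> S (y + z) = S y + S z"
    and antipode_scale: "y \<in> V \<Longrightarrow> S (scale c y) = scale c (S y)"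
    and antipode_left:
      "\<lbrakk>y \<in> V; t \<in> \<Delta> y\<rbrakk> \<Longrightarrow> linear_ext scale (\<lambda>(p, q). mul (S p) q) t = scale (\<epsilon> y) unity"
    and antipode_right:
      "\<lbrakk>y \<in> V; t \<in> \<Delta> y\<rbrakk> \<Longrightarrow> linear_ext scale (\<lambda>(p, q). mul p (S q)) t = scale (\<epsilon> y) unity"


section \<open>The structure maps of the finite dual\<close>

definition dual_scale :: "'k::field \<Rightarrow> ('a \<Rightarrow> 'k) \<Rightarrow> ('a \<Rightarrow> 'k)" where
  "dual_scale c f = (\<lambda>y. c * f y)"

global_interpretation functionals: vector_space "dual_scale :: 'k::field \<Rightarrow> ('a \<Rightarrow> 'k) \<Rightarrow> ('a \<Rightarrow> 'k)"
  by standard (auto simp: dual_scale_def algebra_simps)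

text \<open>\<open>tensor_pairing f e t\<close> is \<open>\<langle>f \<otimes> e, t\<rangle>\<close>.\<close>

definition tensor_pairing :: "('a \<Rightarrow> 'k::field) \<Rightarrow> ('a \<Rightarrow> 'k) \<Rightarrow> ('a \<times> 'a \<Rightarrow>\<^sub>0 'k) \<Rightarrow> 'k" where
  "tensor_pairing f e = linear_ext (*) (\<lambda>(p, q). f p * e q)"

text \<open>
  For linear \<open>f\<close> and \<open>e\<close> the value does not depend on the chosen representative of \<open>\<Delta> y\<close>.
\<close>

definition dual_mult ::
    "('a \<Rightarrow> ('a \<times> 'a \<Rightarrow>\<^sub>0 'k::field) set) \<Rightarrow> ('a \<Rightarrow> 'k) \<Rightarrow> ('a \<Rightarrow> 'k) \<Rightarrow> ('a \<Rightarrow> 'k)" where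
  "dual_mult \<Delta> f e = (\<lambda>y. tensor_pairing f e (SOME t. t \<in> \<Delta> y))"

text \<open>
  The set of all formal sums representing the element \<open>\<Delta>(f)\<close> of \<open>H \<otimes> H\<close> determined by
  \<open>\<langle>\<Delta>(f), y \<otimes> z\<rangle> = \<langle>f, y z\<rangle>\<close>.
\<close>

definition dual_comult ::
    "('a::ring_1 \<Rightarrow> 'k::field) set \<Rightarrow> ('a \<Rightarrow> 'k) \<Rightarrow> (('a \<Rightarrow> 'k) \<times> ('a \<Rightarrow> 'k) \<Rightarrow>\<^sub>0 'k) set" where
  "dual_comult H f =
     {t \<in> formal_tensors H. \<forall>y z. linear_ext (*) (\<lambda>(f1, f2). f1 y * f2 z) t = f (y * z)}"

definition dual_one :: "('a \<Rightarrow> 'k::field) \<Rightarrow> ('a \<Rightarrow> 'k)" where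
  "dual_one \<epsilon> = \<epsilon>"

definition dual_counit :: "('a::ring_1 \<Rightarrow> 'k::field) \<Rightarrow> 'k" where
  "dual_counit f = f 1"

definition dual_antipode :: "('a \<Rightarrow> 'a) \<Rightarrow> ('a \<Rightarrow> 'k::field) \<Rightarrow> ('a \<Rightarrow> 'k)" where
  "dual_antipode S f = f \<circ> S"


section \<open>Modules and matrix coefficients\<close>

text \<open>
  Every finite dimensional left module is isomorphic to a module structure on a coordinate space
  \<open>k\<^sup>n\<close>, and isomorphic modules have the same matrix coefficients.
\<close>

definition left_module ::
    "('k::field \<Rightarrow> 'a::ring_1 \<Rightarrow> 'a) \<Rightarrow> nat \<Rightarrow> ('a \<Rightarrow> 'k mat) \<Rightarrow> bool" where
  "left_module scale n \<rho> \<longleftrightarrow>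
     (\<forall>y. \<rho> y \<in> carrier_mat n n) \<and>
     \<rho> 1 = 1\<^sub>m n \<and>
     (\<forall>y z. \<rho> (y * z) = \<rho> y * \<rho> z) \<and>
     (\<forall>y z. \<rho> (y + z) = \<rho> y + \<rho> z) \<and>
     (\<forall>c y. \<rho> (scale c y) = c \<cdot>\<^sub>m \<rho> y)"

definition diagonalizable :: "'k::field mat \<Rightarrow> bool" where
  "diagonalizable M \<longleftrightarrow> (\<exists>D. diagonal_mat D \<and> similar_mat M D)"

definition category_C ::
    "('k::field \<Rightarrow> 'a::ring_1 \<Rightarrow> 'a) \<Rightarrow> 'a \<Rightarrow> (nat \<times> ('a \<Rightarrow> 'k mat)) set" where
  "category_C scale h =
     {(n, \<rho>). left_module scale n \<rho> \<and>
        diagonalizable (\<rho> (h\<^sup>2)) \<and> (\<forall>l. eigenvalue (\<rho> (h\<^sup>2)) l \<longrightarrow> l \<in> \<int>)}"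

definition cf :: "nat \<times> ('a \<Rightarrow> 'k::field mat) \<Rightarrow> ('a \<Rightarrow> 'k) set" where
  "cf = (\<lambda>(n, \<rho>). functionals.span
     {(\<lambda>y. \<xi> \<bullet> (\<rho> y *\<^sub>v v)) | \<xi> v. \<xi> \<in> carrier_vec n \<and> v \<in> carrier_vec n})"

definition reconstructed ::
    "('k::field \<Rightarrow> 'a::ring_1 \<Rightarrow> 'a) \<Rightarrow> 'a \<Rightarrow> ('a \<Rightarrow> 'k) set" where
  "reconstructed scale h = functionals.span (\<Union>X\<in>category_C scale h. cf X)"


section \<open>The two presentations\<close>

datatype gen_A = Gen_g | Gen_h

definition relations_A :: "(gen_A free_monoid \<Rightarrow>\<^sub>0 'k::field) set" where
  "relations_A =
     {var Gen_g ^ 2 - 1, var Gen_g * var Gen_h + var Gen_h * var Gen_g}"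

datatype gen_H = Gen_u | Gen_x | Gen_a | Gen_a_inv

definition relations_H :: "(gen_H free_monoid \<Rightarrow>\<^sub>0 'k::field) set" where
  "relations_H =
     {var Gen_u ^ 2 - 1,
      var Gen_x ^ 2,
      var Gen_u * var Gen_x + var Gen_x * var Gen_u,
      var Gen_a * var Gen_a_inv - 1,
      var Gen_a_inv * var Gen_a - 1,
      var Gen_u * var Gen_a - var Gen_a * var Gen_u,
      var Gen_a * var Gen_x - var Gen_x * var Gen_a}"

end

theory Submission
  imports Defs
begin

text \<open>
  In \<open>A\<close> the element \<open>h\<^sup>2\<close> is central, and its coproduct is \<open>1 \<otimes> h\<^sup>2 + h\<^sup>2 \<otimes> 1\<close>, because the cross
  terms \<open>gh \<otimes> h\<close> and \<open>hg \<otimes> h\<close> cancel.  On a module in the category, \<open>h\<^sup>2\<close> splits the vectors into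
  eigenvectors with integer eigenvalues, and the idempotents \<open>(1 \<plusminus> g)/2\<close> split the resulting matrix
  coefficients further, so that \<open>H\<close> is spanned by linear functionals \<open>f\<close> with
  \<open>f(g y) = s f(y)\<close> and \<open>f(h\<^sup>2 y) = n f(y)\<close> for a sign \<open>s\<close> and an integer \<open>n\<close>
  (\<open>reconstructed_eq_span\<close>).  The elements \<open>g\<^sup>i h\<^sup>j\<close> span \<open>A\<close>, so such an eigenfunctional is determined
  by \<open>f(1)\<close> and \<open>f(h)\<close>; the two-dimensional representations \<open>g \<mapsto> diag(s, -s)\<close>,
  \<open>h \<mapsto> (0 n; 1 0)\<close> show that both values can be prescribed.  This gives a spanning family of
  even functionals, with \<open>(f(1), f(h)) = (1, 0)\<close>, and odd functionals, with \<open>(0, 1)\<close>, one of each for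
  every pair \<open>(s, n)\<close>.  In characteristic \<open>0\<close> all these pairs are different, and
  evaluation at products of elements \<open>h\<^sup>2 - m\<close> and \<open>1 \<plusminus> g\<close> shows that the family is linearly
  independent (\<open>separating_element\<close>).

  All structure maps can now be read off from values at \<open>1\<close> and \<open>h\<close>.  Since \<open>g\<close> is group-like and
  \<open>h\<^sup>2\<close> is primitive, a product of eigenfunctionals of types \<open>(s, m)\<close> and \<open>(t, n)\<close> is one of type
  \<open>(s t, m + n)\<close>, which yields the multiplication table \<open>convolve_basis\<close>.  With \<open>u\<close> and \<open>x\<close> the even
  and the odd functional of type \<open>(-1, 0)\<close>, and \<open>a\<close>, \<open>a\<^sup>-\<^sup>1\<close> the even ones of types \<open>(1, 1)\<close> and
  \<open>(1, -1)\<close>, the monomials \<open>a\<^sup>n x\<^sup>e u\<^sup>i\<close> with \<open>e, i \<in> {0, 1}\<close> run exactly once through the family.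
  The defining relations rewrite every word in the generators into a combination of these monomials
  (\<open>normal_forms_span\<close>); as their values in \<open>H\<close> are linearly independent, there are no further
  relations.  The coproducts are the multiplicativity of the two-dimensional representations, and
  the antipode follows from it, because composing a matrix representation with the antipode of \<open>A\<close>
  inverts it for convolution (\<open>antipode_basis\<close>).

  The Hopf algebra axioms hold for every space of functionals on \<open>A\<close> that is closed under the
  structure maps (\<open>hopf_algebra_of_functionals\<close>).  Each of them transposes an axiom of \<open>A\<close>, once it is
  known that elements of \<open>H \<otimes> H\<close> and \<open>H \<otimes> H \<otimes> H\<close> are determined by the multilinear forms that they
  define (\<open>functional_tensor2_null\<close>, \<open>functional_tensor3_null\<close>).
\<close>

section \<open>Linear extension of maps from a basis\<close>

text \<open>
  The lemmas below have a premise \<open>vector_space scale\<close>, discharged by the simplifier, so that they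
  apply alike to scalars, formal sums, functionals and the carrier of an abstract algebra.
\<close>

lemma vector_space_field [simp]: "vector_space ((*) :: 'k::field \<Rightarrow> 'k \<Rightarrow> 'k)"
  by standard (auto simp: algebra_simps)

declare free.vector_space_axioms [simp] functionals.vector_space_axioms [simp]

lemma linear_ext_superset:
  assumes "vector_space scale" "finite K" "Poly_Mapping.keys t \<subseteq> K"
  shows "linear_ext scale f t = (\<Sum>i\<in>K. scale (Poly_Mapping.lookup t i) (f i))"
proof -
  interpret vector_space scale by fact
  show ?thesis
    unfolding linear_ext_def
    by (rule sum.mono_neutral_left) (use assms in \<open>auto simp: in_keys_iff\<close>)
qed

lemma linear_ext_add [simp]:
  assumes "vector_space scale"
  shows "linear_ext scale f (s + t) = linear_ext scale f s + linear_ext scale f t"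
proof -
  interpret vector_space scale by fact
  let ?K = "Poly_Mapping.keys s \<union> Poly_Mapping.keys t"
  have "Poly_Mapping.keys (s + t) \<subseteq> ?K" by (rule keys_add)
  then show ?thesis
    using assms linear_ext_superset[of scale ?K]
    by (simp add: lookup_add scale_left_distrib sum.distrib)
qed

lemma linear_ext_scale [simp]:
  assumes "vector_space scale"
  shows "linear_ext scale f (free_scale c t) = scale c (linear_ext scale f t)"
proof -
  interpret vector_space scale by fact
  have "Poly_Mapping.keys (free_scale c t) \<subseteq> Poly_Mapping.keys t"
    by (auto simp: in_keys_iff)
  then show ?thesis
    using assms linear_ext_superset[of scale "Poly_Mapping.keys t"]
    by (simp add: scale_sum_right)
qed

lemma linear_ext_zero [simp]: "linear_ext scale f 0 = 0"
  by (simp add: linear_ext_def)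

lemma linear_ext_diff [simp]:
  assumes "vector_space scale"
  shows "linear_ext scale f (s - t) = linear_ext scale f s - linear_ext scale f t"
  using linear_ext_add[OF assms, of f "s - t" t] by (simp add: algebra_simps)

lemma linear_ext_single [simp]:
  assumes "vector_space scale"
  shows "linear_ext scale f (Poly_Mapping.single i c) = scale c (f i)"
proof -
  interpret vector_space scale by fact
  show ?thesis
    using assms linear_ext_superset[of scale "{i}" "Poly_Mapping.single i c" f] by simp
qed

lemma linear_ext_cong:
  "(\<And>i. i \<in> Poly_Mapping.keys t \<Longrightarrow> f i = f' i) \<Longrightarrow> linear_ext scale f t = linear_ext scale f' t"
  by (simp add: linear_ext_def)

lemma linear_ext_of_singles: "linear_ext free_scale (\<lambda>i. Poly_Mapping.single i 1) t = t"
  by (rule poly_mapping_eqI)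
    (auto simp: linear_ext_def lookup_sum lookup_single when_def in_keys_iff
      if_distrib[of "(*) _"] cong: if_cong)

lemma linear_ext_induct [case_names zero add scale single]:
  assumes "P 0" "\<And>s t. P s \<Longrightarrow> P t \<Longrightarrow> P (s + t)" "\<And>c t. P t \<Longrightarrow> P (free_scale c t)"
    and "\<And>i. P (Poly_Mapping.single i 1)"
  shows "P t"
proof -
  have "P (\<Sum>i\<in>K. free_scale (Poly_Mapping.lookup t i) (Poly_Mapping.single i 1))" if "finite K" for K
    using that by induction (auto intro: assms)
  from this[of "Poly_Mapping.keys t"] show ?thesis
    using linear_ext_of_singles[of t] by (simp add: linear_ext_def)
qed

lemma linear_ext_compose:
  assumes "L 0 = 0" "\<And>v w. L (v + w) = L v + L w" "\<And>c v. L (scale c v) = scale' c (L v)"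
  shows "L (linear_ext scale f t) = linear_ext scale' (\<lambda>i. L (f i)) t"
proof -
  have "L (\<Sum>i\<in>K. scale (c i) (f i)) = (\<Sum>i\<in>K. scale' (c i) (L (f i)))" for c K
    by (induction K rule: infinite_finite_induct) (auto simp: assms)
  then show ?thesis unfolding linear_ext_def .
qed

lemma linear_ext_linear_ext [simp]:
  assumes "vector_space scale"
  shows "linear_ext scale f (linear_ext free_scale G t) = linear_ext scale (\<lambda>i. linear_ext scale f (G i)) t"
  by (rule linear_ext_compose) (simp_all add: assms)

lemma linear_ext_plus_fun:
  assumes "vector_space scale"
  shows "linear_ext scale (\<lambda>i. f i + f' i) t = linear_ext scale f t + linear_ext scale f' t"
proof -
  interpret vector_space scale by fact
  show ?thesis by (simp add: linear_ext_def scale_right_distrib sum.distrib)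
qed

lemma linear_ext_scale_fun:
  assumes "vector_space scale"
  shows "linear_ext scale (\<lambda>i. scale c (f i)) t = scale c (linear_ext scale f t)"
proof -
  interpret vector_space scale by fact
  show ?thesis by (simp add: linear_ext_def scale_sum_right mult.commute)
qed

lemma linear_ext_zero_fun [simp]:
  assumes "vector_space scale"
  shows "linear_ext scale (\<lambda>i. 0) t = 0"
proof -
  interpret vector_space scale by fact
  show ?thesis by (simp add: linear_ext_def)
qed

lemma linear_ext_sum_fun:
  assumes "vector_space scale"
  shows "linear_ext scale (\<lambda>i. \<Sum>j\<in>J. f j i) t = (\<Sum>j\<in>J. linear_ext scale (f j) t)"
  by (induction J rule: infinite_finite_induct) (simp_all add: assms linear_ext_plus_fun)

lemma linear_ext_mult_right:
  "linear_ext (*) f t * (c::'k::field) = linear_ext (*) (\<lambda>i. f i * c) t"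
  by (simp add: linear_ext_def sum_distrib_right mult.assoc)

lemma linear_ext_mult_left:
  "(c::'k::field) * linear_ext (*) f t = linear_ext (*) (\<lambda>i. c * f i) t"
  by (simp add: linear_ext_def sum_distrib_left mult.left_commute)

lemma linear_ext_swap:
  assumes "vector_space scale"
  shows "linear_ext scale (\<lambda>i. linear_ext scale (f i) s) t
    = linear_ext scale (\<lambda>j. linear_ext scale (\<lambda>i. f i j) t) s"
proof -
  interpret vector_space scale by fact
  show ?thesis
    unfolding linear_ext_def scale_sum_right scale_scale
    by (subst sum.swap) (simp add: mult.commute)
qed

lemma linear_ext_dual_apply:
  "linear_ext dual_scale F t y = linear_ext (*) (\<lambda>i. F i y) t"
proof -
  have "sum F' K y = (\<Sum>i\<in>K. F' i y)" for F' and K :: "'c set"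
    by (induction K rule: infinite_finite_induct) auto
  then show ?thesis by (simp add: linear_ext_def dual_scale_def)
qed

lemma free_scale_times_left:
  fixes p q :: "'w::monoid_add \<Rightarrow>\<^sub>0 'k::field"
  shows "free_scale c p * q = free_scale c (p * q)"
  by (simp add: free_scale_def mult_map_scale_conv_mult mult.assoc)

lemma free_scale_times_right:
  fixes p q :: "'w::monoid_add \<Rightarrow>\<^sub>0 'k::field"
  shows "p * free_scale c q = free_scale c (p * q)"
proof (induction p rule: linear_ext_induct)
  case (single v)
  show ?case
    by (simp add: free_scale_def mult_map_scale_conv_mult mult_single mult.assoc[symmetric])
qed (simp_all add: distrib_right free.scale_right_distrib free_scale_times_left free.scale_left_commute
       del: free.scale_scale)

lemma linear_ext_times:
  fixes p q :: "'w::monoid_add \<Rightarrow>\<^sub>0 'k::field"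
  assumes "vector_space scale"
  shows "linear_ext scale f (p * q) = linear_ext scale (\<lambda>v. linear_ext scale (\<lambda>w. f (v + w)) q) p"
proof -
  interpret vector_space scale by fact
  show ?thesis
  proof (induction p rule: linear_ext_induct)
    case (single v)
    show ?case
      by (induction q rule: linear_ext_induct)
         (simp_all add: assms distrib_left free_scale_times_right mult_single)
  qed (simp_all add: assms distrib_right free_scale_times_left)
qed

section \<open>Presented algebras\<close>

text \<open>
  The algebra axioms shared by \<open>A\<close>, the spaces of functionals on \<open>A\<close> and the matrix algebras; the
  evaluation of noncommutative polynomials depends on nothing else.
\<close>

locale algebra_on = vector_space scale
  for scale :: "'k::field \<Rightarrow> 'b::ab_group_add \<Rightarrow> 'b" +
  fixes V :: "'b set"
    and mul :: "'b \<Rightarrow> 'b \<Rightarrow> 'b"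
    and unity :: 'b
  assumes subspace_V: "subspace V"
    and mult_closed: "\<lbrakk>y \<in> V; z \<in> V\<rbrakk> \<Longrightarrow> mul y z \<in> V"
    and mult_assoc: "\<lbrakk>y \<in> V; z \<in> V; w \<in> V\<rbrakk> \<Longrightarrow> mul (mul y z) w = mul y (mul z w)"
    and mult_add_left: "\<lbrakk>y \<in> V; z \<in> V; w \<in> V\<rbrakk> \<Longrightarrow> mul (y + z) w = mul y w + mul z w"
    and mult_add_right: "\<lbrakk>y \<in> V; z \<in> V; w \<in> V\<rbrakk> \<Longrightarrow> mul y (z + w) = mul y z + mul y w"
    and mult_scale_left: "\<lbrakk>y \<in> V; z \<in> V\<rbrakk> \<Longrightarrow> mul (scale c y) z = scale c (mul y z)"
    and mult_scale_right: "\<lbrakk>y \<in> V; z \<in> V\<rbrakk> \<Longrightarrow> mul y (scale c z) = scale c (mul y z)"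
    and one_closed: "unity \<in> V"
    and one_left: "y \<in> V \<Longrightarrow> mul unity y = y"
    and one_right: "y \<in> V \<Longrightarrow> mul y unity = y"

sublocale hopf_algebra \<subseteq> algebra: algebra_on scale V mul unity
  by unfold_locales
    (auto intro: subspace_V mult_closed mult_assoc mult_add_left mult_add_right mult_scale_left
      mult_scale_right one_closed one_left one_right)

context algebra_on
begin

declare vector_space_axioms [simp]

lemma linear_ext_closed:
  assumes "\<And>i. f i \<in> V"
  shows "linear_ext scale f t \<in> V"
  unfolding linear_ext_def by (intro subspace_sum subspace_scale subspace_V assms)

lemma linear_ext_compose_on:
  assumes "\<And>i. f i \<in> V" "L 0 = 0" "\<And>v w. v \<in> V \<Longrightarrow> w \<in> V \<Longrightarrow> L (v + w) = L v + L w"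
    and "\<And>c v. v \<in> V \<Longrightarrow> L (scale c v) = scale' c (L v)"
  shows "L (linear_ext scale f t) = linear_ext scale' (\<lambda>i. L (f i)) t"
proof -
  have "(\<Sum>i\<in>K. scale (c i) (f i)) \<in> V \<and> 
      L (\<Sum>i\<in>K. scale (c i) (f i)) = (\<Sum>i\<in>K. scale' (c i) (L (f i)))" for c K
    by (induction K rule: infinite_finite_induct)
      (auto simp: assms subspace_0 subspace_add subspace_scale subspace_V)
  then show ?thesis unfolding linear_ext_def by blast
qed

lemma mult_zero [simp]: "y \<in> V \<Longrightarrow> mul 0 y = 0" "y \<in> V \<Longrightarrow> mul y 0 = 0"
  using mult_scale_left[of y y 0] mult_scale_right[of y y 0] by simp_all

lemma mult_linear_ext_left:
  assumes "\<And>i. f i \<in> V" "z \<in> V"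
  shows "mul (linear_ext scale f t) z = linear_ext scale (\<lambda>i. mul (f i) z) t"
  by (rule linear_ext_compose_on[where L = "\<lambda>y. mul y z"])
    (simp_all add: assms mult_add_left mult_scale_left)

lemma mult_linear_ext_right:
  assumes "\<And>i. f i \<in> V" "z \<in> V"
  shows "mul z (linear_ext scale f t) = linear_ext scale (\<lambda>i. mul z (f i)) t"
  by (rule linear_ext_compose_on[where L = "mul z"])
    (simp_all add: assms mult_add_right mult_scale_right)

context
  fixes gen :: "'x \<Rightarrow> 'b"
  assumes gen_closed: "range gen \<subseteq> V"
begin

abbreviation eval :: "('x free_monoid \<Rightarrow>\<^sub>0 'k) \<Rightarrow> 'b" where
  "eval \<equiv> eval_free scale mul unity gen"

lemma word_closed: "foldr (\<lambda>i. mul (gen i)) ws unity \<in> V"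
  using gen_closed by (induction ws) (auto intro: one_closed mult_closed)

lemma word_append:
  "foldr (\<lambda>i. mul (gen i)) (v @ w) unity
    = mul (foldr (\<lambda>i. mul (gen i)) v unity) (foldr (\<lambda>i. mul (gen i)) w unity)"
proof (induction v)
  case Nil
  then show ?case using word_closed by (simp add: one_left del: foldr_append)
next
  case (Cons i v)
  have "gen i \<in> V" using gen_closed by auto
  with Cons show ?case
    using word_closed by (simp add: mult_assoc del: foldr_append)
qed

lemma eval_free_closed: "eval p \<in> V"
  unfolding eval_free_def by (intro linear_ext_closed word_closed)

lemma eval_free_add: "eval (p + q) = eval p + eval q"
  and eval_free_diff: "eval (p - q) = eval p - eval q"
  and eval_free_scale: "eval (free_scale c p) = scale c (eval p)"
  and eval_free_zero: "eval 0 = 0"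
  by (simp_all add: eval_free_def)

lemma eval_free_times: "eval (p * q) = mul (eval p) (eval q)"
  unfolding eval_free_def
  by (simp add: linear_ext_times plus_free_monoid_def word_append word_closed linear_ext_closed
      mult_linear_ext_left[OF word_closed] mult_linear_ext_right[OF word_closed word_closed]
      del: foldr_append)

lemma eval_free_one: "eval 1 = unity"
proof -
  have "eval (Poly_Mapping.single 0 1) = unity"
    unfolding eval_free_def by (simp add: zero_free_monoid_def del: single_one)
  then show ?thesis by simp
qed

lemma eval_free_var: "eval (var i) = gen i"
  using gen_closed one_right[of "gen i"] by (simp add: eval_free_def var_def image_subset_iff)

lemma eval_free_power: "eval (p ^ n) = (mul (eval p) ^^ n) unity"
  by (induction n) (simp_all add: eval_free_one eval_free_times)

lemmas eval_free_simps = eval_free_add eval_free_diff eval_free_scale eval_free_zero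
  eval_free_times eval_free_one eval_free_var eval_free_power

lemma two_sided_ideal_eval_kernel: "two_sided_ideal {p. eval p = 0}"
  unfolding two_sided_ideal_def by (auto simp: eval_free_simps eval_free_closed)

lemma ideal_generated_subset_eval_kernel:
  assumes "\<And>r. r \<in> rels \<Longrightarrow> eval r = 0"
  shows "ideal_generated rels \<subseteq> {p. eval p = 0}"
  using two_sided_ideal_eval_kernel assms unfolding ideal_generated_def by blast

end

text \<open>
  The universal property of a presented algebra: evaluating an arbitrary preimage in the free
  algebra is well defined because the kernel is generated by relations that hold in the target.
\<close>

lemma presented_by_hom_exists:
  fixes scale' :: "'k \<Rightarrow> 'c::ab_group_add \<Rightarrow> 'c" and gen :: "'x \<Rightarrow> 'b"
  assumes presented: "presented_by scale V mul unity gen rels"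
    and alg': "algebra_on scale' V' mul' unity'"
    and gen': "range gen' \<subseteq> V'"
    and rels': "\<And>r. r \<in> rels \<Longrightarrow> eval_free scale' mul' unity' gen' r = 0"
  obtains \<phi> where "\<And>y. y \<in> V \<Longrightarrow> \<phi> y \<in> V'" "\<phi> unity = unity'"
    "\<And>y z. y \<in> V \<Longrightarrow> z \<in> V \<Longrightarrow> \<phi> (mul y z) = mul' (\<phi> y) (\<phi> z)"
    "\<And>y z. y \<in> V \<Longrightarrow> z \<in> V \<Longrightarrow> \<phi> (y + z) = \<phi> y + \<phi> z"
    "\<And>c y. y \<in> V \<Longrightarrow> \<phi> (scale c y) = scale' c (\<phi> y)"
    "\<And>i. \<phi> (gen i) = gen' i"
proof -
  interpret B: algebra_on scale' V' mul' unity' by (rule alg')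
  have gen: "range gen \<subseteq> V" and onto: "range (eval gen) = V"
    and ker: "{p. eval gen p = 0} = ideal_generated rels"
    using presented unfolding presented_by_def by auto
  note simps = eval_free_simps[OF gen] and simps' = B.eval_free_simps[OF gen']
  define \<phi> where "\<phi> y = B.eval gen' (SOME p. eval gen p = y)" for y
  have \<phi>_eval: "\<phi> (eval gen p) = B.eval gen' p" for p
  proof -
    let ?q = "SOME q. eval gen q = eval gen p"
    have "eval gen ?q = eval gen p" by (rule someI) (rule refl)
    then have "?q - p \<in> {p. eval gen p = 0}" by (simp add: simps)
    then have "B.eval gen' (?q - p) = 0"
      using ker B.ideal_generated_subset_eval_kernel[OF gen' rels'] by auto
    then show ?thesis by (simp add: simps' \<phi>_def)
  qed
  have lift: "\<exists>p. y = eval gen p" if "y \<in> V" for y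
    using that onto by auto
  show thesis
  proof (rule that[of \<phi>])
    fix y z assume "y \<in> V" "z \<in> V"
    then obtain p q where "y = eval gen p" "z = eval gen q" using lift by meson
    then show "\<phi> (mul y z) = mul' (\<phi> y) (\<phi> z)" "\<phi> (y + z) = \<phi> y + \<phi> z"
      using \<phi>_eval[of "p * q"] \<phi>_eval[of "p + q"] by (simp_all add: \<phi>_eval simps simps')
  next
    fix y c assume "y \<in> V"
    then obtain p where "y = eval gen p" using lift by meson
    then show "\<phi> y \<in> V'" "\<phi> (scale c y) = scale' c (\<phi> y)"
      using \<phi>_eval[of "free_scale c p"]
      by (simp_all add: \<phi>_eval simps simps' B.eval_free_closed[OF gen'])
  next
    show "\<phi> unity = unity'" using \<phi>_eval[of 1] by (simp add: simps simps')
    show "\<phi> (gen i) = gen' i" for i using \<phi>_eval[of "var i"] by (simp add: simps simps')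
  qed
qed

end

section \<open>Tensors of functionals are determined by their values\<close>

lemma slot_rels_vanish:
  assumes "\<And>v w. v \<in> V \<Longrightarrow> w \<in> V \<Longrightarrow> B (slot (v + w)) = B (slot v) + B (slot w)"
    and "\<And>c v. v \<in> V \<Longrightarrow> B (slot (scale c v)) = c * B (slot v)"
    and "r \<in> slot_rels scale V slot"
  shows "linear_ext (*) B r = 0"
  using assms by (auto simp: slot_rels_def)

lemma span_vanish:
  assumes "\<And>r. r \<in> R \<Longrightarrow> linear_ext (*) B r = 0" and "d \<in> free.span R"
  shows "linear_ext (*) B d = 0"
  using assms(2) by (induction rule: free.span_induct_alt) (simp_all add: assms(1))

lemma tensor2_null_vanish:
  assumes "\<And>v w z. v \<in> V \<Longrightarrow> w \<in> V \<Longrightarrow> z \<in> V \<Longrightarrow> B (v + w, z) = B (v, z) + B (w, z)"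
    and "\<And>v w z. v \<in> V \<Longrightarrow> w \<in> V \<Longrightarrow> z \<in> V \<Longrightarrow> B (z, v + w) = B (z, v) + B (z, w)"
    and "\<And>c v z. v \<in> V \<Longrightarrow> z \<in> V \<Longrightarrow> B (scale c v, z) = c * B (v, z)"
    and "\<And>c v z. v \<in> V \<Longrightarrow> z \<in> V \<Longrightarrow> B (z, scale c v) = c * B (z, v)"
    and "d \<in> tensor2_null scale V"
  shows "linear_ext (*) B d = 0"
  using assms(5) unfolding tensor2_null_def
  by (rule span_vanish[rotated])
    (auto elim!: slot_rels_vanish[rotated 2] simp: assms(1-4))

lemma tensor3_null_vanish:
  assumes "\<And>v w z z'. v \<in> V \<Longrightarrow> w \<in> V \<Longrightarrow> z \<in> V \<Longrightarrow> z' \<in> V \<Longrightarrow>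
      B (v + w, z, z') = B (v, z, z') + B (w, z, z') \<and>
      B (z, v + w, z') = B (z, v, z') + B (z, w, z') \<and>
      B (z, z', v + w) = B (z, z', v) + B (z, z', w)"
    and "\<And>c v z z'. v \<in> V \<Longrightarrow> z \<in> V \<Longrightarrow> z' \<in> V \<Longrightarrow>
      B (scale c v, z, z') = c * B (v, z, z') \<and>
      B (z, scale c v, z') = c * B (z, v, z') \<and>
      B (z, z', scale c v) = c * B (z, z', v)"
    and "d \<in> tensor3_null scale V"
  shows "linear_ext (*) B d = 0"
  using assms(3) unfolding tensor3_null_def
  by (rule span_vanish[rotated])
    (auto elim!: slot_rels_vanish[rotated 2] simp: assms(1-2))

text \<open>
  Linearity in one slot, which the defining relations of a tensor product give for sums of two
  vectors and for multiples, extended to finite linear combinations.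
\<close>

lemma slot_expansion:
  assumes "vector_space scale" "module.subspace scale V"
    and N: "free.subspace N" "slot_rels scale V slot \<subseteq> N"
    and "B \<subseteq> V"
  shows "Poly_Mapping.single (slot (\<Sum>b\<in>B. scale (r b) b)) 1
    - (\<Sum>b\<in>B. Poly_Mapping.single (slot b) (r b)) \<in> N"
proof -
  interpret vector_space scale by fact
  have add: "Poly_Mapping.single (slot (v + w)) 1 - Poly_Mapping.single (slot v) 1
      - Poly_Mapping.single (slot w) 1 \<in> N" if "v \<in> V" "w \<in> V" for v w
    using N(2) that unfolding slot_rels_def by blast
  have scl: "Poly_Mapping.single (slot (scale c v)) 1 - Poly_Mapping.single (slot v) c \<in> N"
    if "v \<in> V" for c v
    using N(2) that unfolding slot_rels_def by blast
  have zero: "Poly_Mapping.single (slot 0) 1 \<in> N"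
    using scl[of 0 0] subspace_0[OF assms(2)] by simp
  have "Poly_Mapping.single (slot (\<Sum>b\<in>B. scale (r b) b)) 1
    - (\<Sum>b\<in>B. Poly_Mapping.single (slot b) (r b)) \<in> N \<and> (\<Sum>b\<in>B. scale (r b) b) \<in> V"
    using \<open>B \<subseteq> V\<close>
  proof (induction B rule: infinite_finite_induct)
    case (insert b B)
    let ?s = "\<Sum>b\<in>B. scale (r b) b"
    have V: "b \<in> V" "scale (r b) b \<in> V" "?s \<in> V"
      using insert assms(2) by (auto intro: subspace_scale)
    have "Poly_Mapping.single (slot (scale (r b) b + ?s)) 1
        - Poly_Mapping.single (slot (scale (r b) b)) 1 - Poly_Mapping.single (slot ?s) 1 \<in> N"
      by (rule add) (use V in auto)
    from free.subspace_add[OF N(1) free.subspace_add[OF N(1) this scl[of b "r b"]]]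
    show ?case
      using insert V subspace_add[OF assms(2)] by (force simp: algebra_simps)
  qed (use zero subspace_0[OF assms(2)] in auto)
  then show ?thesis by blast
qed

text \<open>
  Coordinates with respect to a basis \<open>C\<close> of the span of finitely many functionals.  The last property
  says that coordinate maps are linear: a weighted sum of functionals that vanishes at every argument
  vanishes in every coordinate.  It is stated for formal sums so that it can be applied to one tensor
  factor after the other, the remaining factors entering as weights \<open>d\<close>.
\<close>

lemma finite_coordinates:
  fixes K :: "('a \<Rightarrow> 'k::field) set"
  assumes "finite K"
  obtains C r where "finite C" "C \<subseteq> K"
    and "\<And>f. f \<in> K \<Longrightarrow> (\<Sum>b\<in>C. dual_scale (r f b) b) = f"
    and "\<And>(t :: 'i \<Rightarrow>\<^sub>0 'k) F d b. F ` Poly_Mapping.keys t \<subseteq> K \<Longrightarrow>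
      (\<And>y. linear_ext (*) (\<lambda>i. d i * F i y) t = 0) \<Longrightarrow> b \<in> C \<Longrightarrow>
      linear_ext (*) (\<lambda>i. d i * r (F i) b) t = 0"
proof -
  obtain C where C: "C \<subseteq> K" "functionals.independent C" "K \<subseteq> functionals.span C"
    using functionals.maximal_independent_subset by blast
  have "finite C" using C(1) assms by (rule finite_subset)
  define r where "r = functionals.representation C"
  have expand: "(\<Sum>b\<in>C. dual_scale (r f b) b) = f" if "f \<in> K" for f
    unfolding r_def
    using functionals.sum_representation_eq[OF C(2) _ \<open>finite C\<close>] C(3) that by blast
  have separate: "linear_ext (*) (\<lambda>i. d i * r (F i) b) t = 0"
    if F: "F ` Poly_Mapping.keys t \<subseteq> K" and zero: "\<And>y. linear_ext (*) (\<lambda>i. d i * F i y) t = 0"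
      and b: "b \<in> C" for t :: "'i \<Rightarrow>\<^sub>0 'k" and F d b
  proof -
    have sum_apply: "sum G J y = (\<Sum>j\<in>J. G j y)" for G :: "_ \<Rightarrow> 'a \<Rightarrow> 'k" and J y
      by (induction J rule: infinite_finite_induct) auto
    have apply_expand: "F i y = (\<Sum>b\<in>C. r (F i) b * b y)" if "i \<in> Poly_Mapping.keys t" for i y
      using arg_cong[OF expand[of "F i"], of "\<lambda>f. f y"] F that
      by (simp add: sum_apply dual_scale_def image_subset_iff)
    have "(\<Sum>b\<in>C. dual_scale (linear_ext (*) (\<lambda>i. d i * r (F i) b) t) b) = 0"
    proof
      fix y
      have "0 = linear_ext (*) (\<lambda>i. d i * F i y) t" by (simp add: zero)
      also have "\<dots> = linear_ext (*) (\<lambda>i. \<Sum>b\<in>C. d i * r (F i) b * b y) t"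
        by (rule linear_ext_cong) (simp add: apply_expand sum_distrib_left mult.assoc)
      also have "\<dots> = (\<Sum>b\<in>C. dual_scale (linear_ext (*) (\<lambda>i. d i * r (F i) b) t) b) y"
        by (simp add: linear_ext_sum_fun linear_ext_mult_right sum_apply dual_scale_def)
      finally show "(\<Sum>b\<in>C. dual_scale (linear_ext (*) (\<lambda>i. d i * r (F i) b) t) b) y = 0 y"
        by simp
    qed
    from functionals.independentD[OF C(2) \<open>finite C\<close> subset_refl this b] show ?thesis .
  qed
  show thesis using \<open>finite C\<close> C(1) expand separate by (rule that)
qed

lemma linear_ext_free_closed:
  assumes "free.subspace N" "\<And>i. i \<in> Poly_Mapping.keys t \<Longrightarrow> F i \<in> N"
  shows "linear_ext free_scale F t \<in> N"
  unfolding linear_ext_def by (intro free.subspace_sum free.subspace_scale assms)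

lemma free_subspace_keys: "free.subspace {t :: 'x \<Rightarrow>\<^sub>0 'k::field. Poly_Mapping.keys t \<subseteq> K}"
proof (rule free.subspaceI)
  fix s t :: "'x \<Rightarrow>\<^sub>0 'k"
  assume "s \<in> {t. Poly_Mapping.keys t \<subseteq> K}" "t \<in> {t. Poly_Mapping.keys t \<subseteq> K}"
  then show "s + t \<in> {t. Poly_Mapping.keys t \<subseteq> K}" using keys_add[of s t] by blast
qed (auto simp: in_keys_iff)

lemma linear_ext_minus_fun:
  "linear_ext free_scale (\<lambda>i. f i - f' i) t = linear_ext free_scale f t - linear_ext free_scale f' t"
  using linear_ext_plus_fun[OF free.vector_space_axioms, of "\<lambda>i. f i - f' i" f' t]
  by (simp add: algebra_simps)

lemma linear_ext_single_fun:
  "linear_ext free_scale (\<lambda>i. Poly_Mapping.single x (d i)) t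
    = Poly_Mapping.single x (linear_ext (*) d t)"
  by (rule poly_mapping_eqI)
    (simp add: linear_ext_def lookup_sum lookup_single when_def)

text \<open>
  Modulo bilinearity a tensor is a combination of the \<open>b \<otimes> b'\<close> with \<open>b\<close>, \<open>b'\<close> from a basis, and its
  coefficients are obtained from the values by taking coordinates in one factor at a time; if all
  values vanish, so do all coefficients.
\<close>

theorem functional_tensor2_null:
  fixes V :: "('a \<Rightarrow> 'k::field) set"
  assumes V: "functionals.subspace V" and keys: "Poly_Mapping.keys t \<subseteq> V \<times> V"
    and zero: "\<And>y z. linear_ext (*) (\<lambda>(v, w). v y * w z) t = 0"
  shows "t \<in> tensor2_null dual_scale V"
proof -
  have zero': "linear_ext (*) (\<lambda>i. fst i y * snd i z) t = 0" for y z
    using zero[of y z] by (simp add: case_prod_unfold)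
  let ?N = "tensor2_null dual_scale V" and ?K = "fst ` Poly_Mapping.keys t \<union> snd ` Poly_Mapping.keys t"
  have N: "free.subspace ?N" by (simp add: tensor2_null_def)
  obtain C r where C: "finite C" "C \<subseteq> ?K"
    and expand: "\<And>f. f \<in> ?K \<Longrightarrow> (\<Sum>b\<in>C. dual_scale (r f b) b) = f"
    and separate: "\<And>(t :: ('a \<Rightarrow> 'k) \<times> ('a \<Rightarrow> 'k) \<Rightarrow>\<^sub>0 'k) F d b. F ` Poly_Mapping.keys t \<subseteq> ?K \<Longrightarrow>
      (\<And>y. linear_ext (*) (\<lambda>i. d i * F i y) t = 0) \<Longrightarrow> b \<in> C \<Longrightarrow>
      linear_ext (*) (\<lambda>i. d i * r (F i) b) t = 0"
    by (rule finite_coordinates[of ?K]) auto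
  have KV: "?K \<subseteq> V" using keys by force
  with C(2) have CV: "C \<subseteq> V" by (rule subset_trans)
  define E where "E = (\<lambda>(v, w). \<Sum>b\<in>C. \<Sum>b'\<in>C. Poly_Mapping.single (b, b') (r v b * r w b'))"
  have "Poly_Mapping.single i 1 - E i \<in> ?N" if "i \<in> Poly_Mapping.keys t" for i
  proof -
    obtain v w where i: "i = (v, w)" by (cases i)
    with that have vw: "v \<in> ?K" "w \<in> ?K" by force+
    have slot: "slot_rels dual_scale V (\<lambda>v. (v, b)) \<subseteq> ?N" "slot_rels dual_scale V (\<lambda>v. (b, v)) \<subseteq> ?N"
      if "b \<in> V" for b
      using that unfolding tensor2_null_def by (auto intro: free.span_base)
    have "Poly_Mapping.single (v, w) 1 - (\<Sum>b\<in>C. Poly_Mapping.single (b, w) (r v b)) \<in> ?N"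
      using slot_expansion[OF functionals.vector_space_axioms V N slot(1)[of w] CV, of "r v"]
        expand[OF vw(1)] vw KV by auto
    moreover have "(\<Sum>b\<in>C. free_scale (r v b)
        (Poly_Mapping.single (b, w) 1 - (\<Sum>b'\<in>C. Poly_Mapping.single (b, b') (r w b')))) \<in> ?N"
      using slot_expansion[OF functionals.vector_space_axioms V N slot(2) CV, of _ "r w"]
        expand[OF vw(2)] CV
      by (intro free.subspace_sum[OF N] free.subspace_scale[OF N]) auto
    ultimately have "Poly_Mapping.single (v, w) 1 - (\<Sum>b\<in>C. Poly_Mapping.single (b, w) (r v b))
      + (\<Sum>b\<in>C. free_scale (r v b)
        (Poly_Mapping.single (b, w) 1 - (\<Sum>b'\<in>C. Poly_Mapping.single (b, b') (r w b')))) \<in> ?N"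
      by (rule free.subspace_add[OF N])
    moreover have "free_scale c (Poly_Mapping.single x d) = Poly_Mapping.single x (c * d)"
      for c d :: 'k and x :: "('a \<Rightarrow> 'k) \<times> ('a \<Rightarrow> 'k)"
      by (rule poly_mapping_eqI) (simp add: lookup_single when_def)
    ultimately show ?thesis
      by (simp add: i E_def free.scale_right_diff_distrib free.scale_sum_right sum_subtractf)
  qed
  then have "linear_ext free_scale (\<lambda>i. Poly_Mapping.single i 1 - E i) t \<in> ?N"
    by (rule linear_ext_free_closed[OF N])
  then have "t - linear_ext free_scale E t \<in> ?N"
    by (simp add: linear_ext_minus_fun linear_ext_of_singles)
  moreover have "linear_ext (*) (\<lambda>i. r (fst i) b * r (snd i) b') t = 0" if "b \<in> C" "b' \<in> C" for b b'
  proof (rule separate)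
    fix z
    have "linear_ext (*) (\<lambda>i. snd i z * r (fst i) b) t = 0"
      by (rule separate) (use zero' that in \<open>auto simp: mult.commute\<close>)
    then show "linear_ext (*) (\<lambda>i. r (fst i) b * snd i z) t = 0" by (simp add: mult.commute)
  qed (use that in auto)
  then have "linear_ext free_scale E t = 0"
    by (simp add: E_def case_prod_unfold linear_ext_sum_fun linear_ext_single_fun)
  ultimately show ?thesis by simp
qed

text \<open>
  The same argument with three factors, needed for coassociativity.
\<close>

theorem functional_tensor3_null:
  fixes V :: "('a \<Rightarrow> 'k::field) set"
  assumes subspace_V: "functionals.subspace V" and keys: "Poly_Mapping.keys t \<subseteq> V \<times> V \<times> V"
    and zero: "\<And>x y z. linear_ext (*) (\<lambda>(u, v, w). u x * v y * w z) t = 0"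
  shows "t \<in> tensor3_null dual_scale V"
proof -
  have zero': "linear_ext (*) (\<lambda>i. fst i x * (fst (snd i) y * snd (snd i) z)) t = 0" for x y z
    using zero[of x y z] by (simp add: case_prod_unfold mult.assoc)
  let ?N = "tensor3_null dual_scale V" and ?K = "fst ` Poly_Mapping.keys t \<union>
    (fst \<circ> snd) ` Poly_Mapping.keys t \<union> (snd \<circ> snd) ` Poly_Mapping.keys t"
  have N: "free.subspace ?N" by (simp add: tensor3_null_def)
  obtain C r where C: "finite C" "C \<subseteq> ?K"
    and expand: "\<And>f. f \<in> ?K \<Longrightarrow> (\<Sum>b\<in>C. dual_scale (r f b) b) = f"
    and separate: "\<And>(t :: ('a \<Rightarrow> 'k) \<times> ('a \<Rightarrow> 'k) \<times> ('a \<Rightarrow> 'k) \<Rightarrow>\<^sub>0 'k) F d b.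
      F ` Poly_Mapping.keys t \<subseteq> ?K \<Longrightarrow>
      (\<And>y. linear_ext (*) (\<lambda>i. d i * F i y) t = 0) \<Longrightarrow> b \<in> C \<Longrightarrow>
      linear_ext (*) (\<lambda>i. d i * r (F i) b) t = 0"
    by (rule finite_coordinates[of ?K]) auto
  have KV: "?K \<subseteq> V" using keys by force
  with C(2) have CV: "C \<subseteq> V" by (rule subset_trans)
  have single_scale: "free_scale c (Poly_Mapping.single x d) = Poly_Mapping.single x (c * d)"
    for c d :: 'k and x :: "('a \<Rightarrow> 'k) \<times> ('a \<Rightarrow> 'k) \<times> ('a \<Rightarrow> 'k)"
    by (rule poly_mapping_eqI) (simp add: lookup_single when_def)
  define E where "E = (\<lambda>(u, v, w). \<Sum>b\<in>C. \<Sum>b'\<in>C. \<Sum>b''\<in>C.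
    Poly_Mapping.single (b, b', b'') (r u b * r v b' * r w b''))"
  have "Poly_Mapping.single i 1 - E i \<in> ?N" if "i \<in> Poly_Mapping.keys t" for i
  proof -
    obtain u v w where i: "i = (u, v, w)" by (cases i)
    with that have uvw: "u \<in> ?K" "v \<in> ?K" "w \<in> ?K" by force+
    with KV have V: "u \<in> V" "v \<in> V" "w \<in> V" by blast+
    have slot: "slot_rels dual_scale V (\<lambda>v. (v, b, b')) \<subseteq> ?N"
      "slot_rels dual_scale V (\<lambda>v. (b, v, b')) \<subseteq> ?N"
      "slot_rels dual_scale V (\<lambda>v. (b, b', v)) \<subseteq> ?N"
      if "b \<in> V" "b' \<in> V" for b b'
      using that unfolding tensor3_null_def by (auto intro: free.span_base)
    have expand_u: "Poly_Mapping.single (u, b, b') 1 - (\<Sum>c\<in>C. Poly_Mapping.single (c, b, b') (r u c)) \<in> ?N"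
      and expand_v: "Poly_Mapping.single (b, v, b') 1 - (\<Sum>c\<in>C. Poly_Mapping.single (b, c, b') (r v c)) \<in> ?N"
      and expand_w: "Poly_Mapping.single (b, b', w) 1 - (\<Sum>c\<in>C. Poly_Mapping.single (b, b', c) (r w c)) \<in> ?N"
      if "b \<in> V" "b' \<in> V" for b b'
      using slot_expansion[OF functionals.vector_space_axioms subspace_V N slot(1)[OF that] CV, of "r u"]
        slot_expansion[OF functionals.vector_space_axioms subspace_V N slot(2)[OF that] CV, of "r v"]
        slot_expansion[OF functionals.vector_space_axioms subspace_V N slot(3)[OF that] CV, of "r w"]
      by (simp_all only: expand[OF uvw(1)] expand[OF uvw(2)] expand[OF uvw(3)])
    have "Poly_Mapping.single (u, v, w) 1 - (\<Sum>b\<in>C. Poly_Mapping.single (b, v, w) (r u b)) \<in> ?N"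
      by (rule expand_u) (rule V)+
    moreover have "(\<Sum>b\<in>C. free_scale (r u b)
        (Poly_Mapping.single (b, v, w) 1 - (\<Sum>b'\<in>C. Poly_Mapping.single (b, b', w) (r v b')))) \<in> ?N"
      using CV V by (intro free.subspace_sum[OF N] free.subspace_scale[OF N] expand_v) auto
    moreover have "(\<Sum>b\<in>C. \<Sum>b'\<in>C. free_scale (r u b * r v b') (Poly_Mapping.single (b, b', w) 1
        - (\<Sum>b''\<in>C. Poly_Mapping.single (b, b', b'') (r w b'')))) \<in> ?N"
      using CV by (intro free.subspace_sum[OF N] free.subspace_scale[OF N] expand_w) auto
    ultimately have "Poly_Mapping.single (u, v, w) 1 - (\<Sum>b\<in>C. Poly_Mapping.single (b, v, w) (r u b))
      + (\<Sum>b\<in>C. free_scale (r u b)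
        (Poly_Mapping.single (b, v, w) 1 - (\<Sum>b'\<in>C. Poly_Mapping.single (b, b', w) (r v b'))))
      + (\<Sum>b\<in>C. \<Sum>b'\<in>C. free_scale (r u b * r v b') (Poly_Mapping.single (b, b', w) 1
        - (\<Sum>b''\<in>C. Poly_Mapping.single (b, b', b'') (r w b'')))) \<in> ?N"
      by (intro free.subspace_add[OF N])
    then show ?thesis
      by (simp add: i E_def free.scale_right_diff_distrib free.scale_sum_right sum_subtractf
          single_scale)
  qed
  then have "linear_ext free_scale (\<lambda>i. Poly_Mapping.single i 1 - E i) t \<in> ?N"
    by (rule linear_ext_free_closed[OF N])
  then have "t - linear_ext free_scale E t \<in> ?N"
    by (simp add: linear_ext_minus_fun linear_ext_of_singles)
  moreover have "linear_ext (*) (\<lambda>i. r (fst i) b * r (fst (snd i)) b' * r (snd (snd i)) b'') t = 0"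
    if C: "b \<in> C" "b' \<in> C" "b'' \<in> C" for b b' b''
  proof (rule separate)
    fix z
    have "linear_ext (*) (\<lambda>i. r (fst i) b * snd (snd i) z * r (fst (snd i)) b') t = 0"
    proof (rule separate)
      fix y
      have "linear_ext (*) (\<lambda>i. fst (snd i) y * snd (snd i) z * r (fst i) b) t = 0"
        by (rule separate) (use zero' C in \<open>auto simp: ac_simps\<close>)
      then show "linear_ext (*) (\<lambda>i. r (fst i) b * snd (snd i) z * fst (snd i) y) t = 0"
        by (simp add: ac_simps)
    qed (use C in auto)
    then show "linear_ext (*) (\<lambda>i. r (fst i) b * r (fst (snd i)) b' * snd (snd i) z) t = 0"
      by (simp add: ac_simps)
  qed (use C in auto)
  then have "linear_ext free_scale E t = 0"
    by (simp add: E_def case_prod_unfold linear_ext_sum_fun linear_ext_single_fun)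
  ultimately show ?thesis by simp
qed

section \<open>Hopf algebras of functionals\<close>

lemma linear_ext_product:
  fixes f :: "'x \<Rightarrow> 'k::field" and e :: "'y \<Rightarrow> 'k"
  shows "linear_ext (*) f s * linear_ext (*) e t
    = linear_ext (*) (\<lambda>i. linear_ext (*) (\<lambda>j. f i * e j) t) s"
  by (subst linear_ext_mult_right) (simp add: linear_ext_mult_left)

lemma tensor_mult_eval:
  "linear_ext (*) B (tensor_mult mul s t) =
     linear_ext (*) (\<lambda>p. linear_ext (*)
       (\<lambda>q. B (mul (fst p) (fst q), mul (snd p) (snd q))) t) s"
  by (simp add: tensor_mult_def pure_tensor_def case_prod_unfold)

definition linear_functionals ::
    "('k::field \<Rightarrow> 'a::ab_group_add \<Rightarrow> 'a) \<Rightarrow> ('a \<Rightarrow> 'k) set" where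
  "linear_functionals scale = {f. (\<forall>y z. f (y + z) = f y + f z) \<and> (\<forall>c y. f (scale c y) = c * f y)}"

lemma linear_functionalsD:
  assumes "f \<in> linear_functionals scale"
  shows "f (y + z) = f y + f z" "f (scale c y) = c * f y"
  using assms by (auto simp: linear_functionals_def)

lemma linear_functionals_linear_ext:
  assumes "f \<in> linear_functionals scale"
  shows "f (linear_ext scale F t) = linear_ext (*) (\<lambda>i. f (F i)) t"
proof (rule linear_ext_compose)
  show "f 0 = 0"
    using linear_functionalsD(1)[OF assms, of 0 0] by (metis add_0 add_cancel_right_left)
qed (rule linear_functionalsD[OF assms])+

lemma subspace_linear_functionals: "functionals.subspace (linear_functionals scale)"
  by (rule functionals.subspaceI) (auto simp: linear_functionals_def dual_scale_def algebra_simps)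

lemma dual_comult_mono: "H \<subseteq> H' \<Longrightarrow> dual_comult H f \<subseteq> dual_comult H' f"
  unfolding dual_comult_def formal_tensors_def by blast

text \<open>
  A single representative determines \<open>\<Delta>(f)\<close>, since two formal tensors with the same values represent
  the same tensor.
\<close>

lemma dual_comult_eq_tensor_class:
  assumes "functionals.subspace H" "t \<in> dual_comult H f"
  shows "dual_comult H f = tensor_class dual_scale H t"
proof (intro subset_antisym subsetI)
  have t: "t \<in> formal_tensors H" and t_eval: "linear_ext (*) (\<lambda>(f1, f2). f1 y * f2 z) t = f (y * z)" for y z
    using assms(2) by (auto simp: dual_comult_def)
  {
    fix s assume s: "s \<in> dual_comult H f"
    then have "s \<in> formal_tensors H" by (simp add: dual_comult_def)
    moreover have "s - t \<in> tensor2_null dual_scale H"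
    proof (rule functional_tensor2_null[OF assms(1)])
      show "Poly_Mapping.keys (s - t) \<subseteq> H \<times> H"
        using free.subspace_diff[OF free_subspace_keys] \<open>s \<in> formal_tensors H\<close> t
        unfolding formal_tensors_def by blast
      show "linear_ext (*) (\<lambda>(v, w). v y * w z) (s - t) = 0" for y z
        using s t_eval by (simp add: dual_comult_def)
    qed
    ultimately show "s \<in> tensor_class dual_scale H t" by (simp add: tensor_class_def)
  next
    fix s assume s: "s \<in> tensor_class dual_scale H t"
    have "linear_ext (*) (\<lambda>(f1, f2). f1 y * f2 z) (s - t) = 0" for y z
      by (rule tensor2_null_vanish[of H _ dual_scale])
        (use s in \<open>auto simp: tensor_class_def dual_scale_def algebra_simps\<close>)
    then show "s \<in> dual_comult H f"
      using s t_eval by (simp add: dual_comult_def tensor_class_def)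
  }
qed

lemma tensor_squareD:
  assumes "T \<in> tensor_square scale V"
  shows "\<exists>t. t \<in> T" "s \<in> T \<Longrightarrow> t \<in> T \<Longrightarrow> s - t \<in> tensor2_null scale V"
proof -
  obtain r where r: "r \<in> formal_tensors V" "T = tensor_class scale V r"
    using assms by (auto simp: tensor_square_def)
  have "r \<in> T" using r by (simp add: tensor_class_def tensor2_null_def free.span_zero)
  then show "\<exists>t. t \<in> T" ..
  assume "s \<in> T" "t \<in> T"
  then have "s - r \<in> tensor2_null scale V" "t - r \<in> tensor2_null scale V"
    by (simp_all add: r(2) tensor_class_def)
  then have "(s - r) - (t - r) \<in> tensor2_null scale V"
    unfolding tensor2_null_def by (rule free.span_diff)
  then show "s - t \<in> tensor2_null scale V" by simp
qed

locale hopf_ring = hopf_algebra scale UNIV "(*)" 1 \<Delta> \<epsilon> S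
  for scale :: "'k::field \<Rightarrow> 'a::ring_1 \<Rightarrow> 'a"
    and \<Delta> :: "'a \<Rightarrow> ('a \<times> 'a \<Rightarrow>\<^sub>0 'k) set"
    and \<epsilon> :: "'a \<Rightarrow> 'k"
    and S :: "'a \<Rightarrow> 'a"
begin

abbreviation A_dual :: "('a \<Rightarrow> 'k) set" where
  "A_dual \<equiv> linear_functionals scale"

abbreviation convolve :: "('a \<Rightarrow> 'k) \<Rightarrow> ('a \<Rightarrow> 'k) \<Rightarrow> ('a \<Rightarrow> 'k)" (infixl \<open>\<diamondop>\<close> 70) where
  "f \<diamondop> e \<equiv> dual_mult \<Delta> f e"

lemma comult_obtain: obtains t where "t \<in> \<Delta> y"
  using tensor_squareD(1)[OF comult_closed] by blast

lemma convolve_apply: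
  assumes f: "f \<in> A_dual" and e: "e \<in> A_dual" and t: "t \<in> \<Delta> y"
  shows "(f \<diamondop> e) y = linear_ext (*) (\<lambda>p. f (fst p) * e (snd p)) t"
proof -
  let ?s = "SOME t. t \<in> \<Delta> y"
  have "?s \<in> \<Delta> y" using t by (rule someI)
  then have "?s - t \<in> tensor2_null scale UNIV"
    using tensor_squareD(2)[OF comult_closed] t by blast
  then have "linear_ext (*) (\<lambda>p. f (fst p) * e (snd p)) (?s - t) = 0"
    by (rule tensor2_null_vanish[rotated -1])
      (simp_all add: linear_functionalsD[OF f] linear_functionalsD[OF e] algebra_simps)
  then show ?thesis
    by (simp add: dual_mult_def tensor_pairing_def case_prod_unfold)
qed

lemma convolve_closed:
  assumes f: "f \<in> A_dual" and e: "e \<in> A_dual"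
  shows "f \<diamondop> e \<in> A_dual"
proof -
  have "(f \<diamondop> e) (y + z) = (f \<diamondop> e) y + (f \<diamondop> e) z" for y z
  proof -
    obtain s t where "s \<in> \<Delta> y" "t \<in> \<Delta> z" using comult_obtain by metis
    then show ?thesis
      using convolve_apply[OF f e] comult_add[of y z s t] by simp
  qed
  moreover have "(f \<diamondop> e) (scale c y) = c * (f \<diamondop> e) y" for c y
  proof -
    obtain s where "s \<in> \<Delta> y" using comult_obtain .
    then show ?thesis
      using convolve_apply[OF f e] comult_scale[of y s c] by simp
  qed
  ultimately show ?thesis by (simp add: linear_functionals_def)
qed

lemma counit_functional: "\<epsilon> \<in> A_dual"
  by (simp add: linear_functionals_def counit_add counit_scale)

lemma linear_functional_antipode:
  assumes "f \<in> A_dual"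
  shows "dual_antipode S f \<in> A_dual"
  using assms by (simp add: linear_functionals_def dual_antipode_def antipode_add antipode_scale)

text \<open>
  Both sides evaluate \<open>f \<otimes> e \<otimes> d\<close> at an iterated coproduct, and a trilinear form does not see the
  difference of the two iterated coproducts.
\<close>

lemma convolve_assoc:
  assumes f: "f \<in> A_dual" and e: "e \<in> A_dual" and d: "d \<in> A_dual"
  shows "(f \<diamondop> e) \<diamondop> d = f \<diamondop> (e \<diamondop> d)"
proof
  fix y
  \<comment> \<open>Coassociativity is stated for a choice of representatives of all coproducts.\<close>
  define D where "D p = (SOME t. t \<in> \<Delta> p)" for p
  have D: "D p \<in> \<Delta> p" for p
    unfolding D_def using tensor_squareD(1)[OF comult_closed] by (rule someI_ex) simp
  obtain t where t: "t \<in> \<Delta> y" using comult_obtain .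
  let ?B = "\<lambda>(p, q, r). f p * e q * d r"
  have "linear_ext (*) ?B (linear_ext free_scale (\<lambda>(p, q).
             linear_ext free_scale (\<lambda>(p1, p2). Poly_Mapping.single (p1, p2, q) 1) (D p)) t
         - linear_ext free_scale (\<lambda>(p, q).
             linear_ext free_scale (\<lambda>(q1, q2). Poly_Mapping.single (p, q1, q2) 1) (D q)) t) = 0"
    by (rule tensor3_null_vanish[OF _ _ coassoc[OF UNIV_I t D]])
      (simp_all add: linear_functionalsD[OF f] linear_functionalsD[OF e]
        linear_functionalsD[OF d] algebra_simps)
  moreover have "((f \<diamondop> e) \<diamondop> d) y = linear_ext (*) ?B (linear_ext free_scale (\<lambda>(p, q).
             linear_ext free_scale (\<lambda>(p1, p2). Poly_Mapping.single (p1, p2, q) 1) (D p)) t)"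
    by (simp add: convolve_apply[OF convolve_closed[OF f e] d t] convolve_apply[OF f e D]
        linear_ext_mult_right case_prod_unfold)
  moreover have "(f \<diamondop> (e \<diamondop> d)) y = linear_ext (*) ?B (linear_ext free_scale (\<lambda>(p, q).
             linear_ext free_scale (\<lambda>(q1, q2). Poly_Mapping.single (p, q1, q2) 1) (D q)) t)"
    by (simp add: convolve_apply[OF f convolve_closed[OF e d] t] convolve_apply[OF e d D]
        linear_ext_mult_left case_prod_unfold mult.assoc)
  ultimately show "((f \<diamondop> e) \<diamondop> d) y = (f \<diamondop> (e \<diamondop> d)) y" by simp
qed

lemma convolve_counit_left:
  assumes f: "f \<in> A_dual"
  shows "\<epsilon> \<diamondop> f = f"
proof
  fix y
  obtain t where t: "t \<in> \<Delta> y" using comult_obtain .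
  have "f y = f (linear_ext scale (\<lambda>(p, q). scale (\<epsilon> p) q) t)"
    by (simp add: counit_left[OF UNIV_I t])
  also have "\<dots> = (\<epsilon> \<diamondop> f) y"
    by (simp add: linear_functionals_linear_ext[OF f] convolve_apply[OF counit_functional f t]
        case_prod_unfold linear_functionalsD[OF f])
  finally show "(\<epsilon> \<diamondop> f) y = f y" ..
qed

lemma convolve_counit_right:
  assumes f: "f \<in> A_dual"
  shows "f \<diamondop> \<epsilon> = f"
proof
  fix y
  obtain t where t: "t \<in> \<Delta> y" using comult_obtain .
  have "f y = f (linear_ext scale (\<lambda>(p, q). scale (\<epsilon> q) p) t)"
    by (simp add: counit_right[OF UNIV_I t])
  also have "\<dots> = (f \<diamondop> \<epsilon>) y"
    by (simp add: linear_functionals_linear_ext[OF f] convolve_apply[OF f counit_functional t]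
        case_prod_unfold linear_functionalsD[OF f] mult.commute)
  finally show "(f \<diamondop> \<epsilon>) y = f y" ..
qed

lemma algebra_on_functionals:
  assumes H: "functionals.subspace H" "H \<subseteq> A_dual" "\<epsilon> \<in> H"
    and closed: "\<And>f e. f \<in> H \<Longrightarrow> e \<in> H \<Longrightarrow> f \<diamondop> e \<in> H"
  shows "algebra_on dual_scale H (\<diamondop>) \<epsilon>"
proof
  fix f e d :: "'a \<Rightarrow> 'k" and c
  show "\<epsilon> \<diamondop> f = f" "f \<diamondop> \<epsilon> = f" if "f \<in> H"
    using that H(2) convolve_counit_left convolve_counit_right by blast+
  show "(f \<diamondop> e) \<diamondop> d = f \<diamondop> (e \<diamondop> d)" if "f \<in> H" "e \<in> H" "d \<in> H"
    using that H(2) convolve_assoc by blast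
  show "(f + e) \<diamondop> d = f \<diamondop> d + e \<diamondop> d" "d \<diamondop> (f + e) = d \<diamondop> f + d \<diamondop> e"
    by (auto simp: dual_mult_def tensor_pairing_def case_prod_unfold distrib_left distrib_right
        linear_ext_plus_fun)
  show "dual_scale c f \<diamondop> e = dual_scale c (f \<diamondop> e)" "e \<diamondop> dual_scale c f = dual_scale c (e \<diamondop> f)"
    by (auto simp: linear_ext_scale_fun[OF vector_space_field] dual_mult_def tensor_pairing_def
        case_prod_unfold dual_scale_def mult.assoc
       mult.left_commute)
qed (use assms in auto)

text \<open>
  Multiplicativity of the coproduct of \<open>A\<close>: translating a convolution by \<open>z\<close> translates its factors by
  the two tensor factors of \<open>\<Delta> z\<close>.  With \<open>z = g\<close> and \<open>z = h\<close> this computes convolutions recursively.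
\<close>

lemma convolve_translate:
  assumes f: "f \<in> A_dual" and e: "e \<in> A_dual" and s: "s \<in> \<Delta> z"
  shows "(f \<diamondop> e) (z * y)
    = linear_ext (*) (\<lambda>p. ((\<lambda>y. f (fst p * y)) \<diamondop> (\<lambda>y. e (snd p * y))) y) s"
proof -
  obtain t where t: "t \<in> \<Delta> y" using comult_obtain .
  have translate: "(\<lambda>y. g (p * y)) \<in> A_dual" if "g \<in> A_dual" for g p
    using that by (simp add: linear_functionals_def distrib_left mult_scale_right)
  show ?thesis
    using convolve_apply[OF f e comult_mult[OF _ _ s t]]
    by (simp add: tensor_mult_eval convolve_apply[OF translate[OF f] translate[OF e] t])
qed

text \<open>
  Multiplicativity of the coproduct of functionals is again multiplicativity of the coproduct of \<open>A\<close>: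
  both sides pair four tensor factors of functionals with four of elements, in a different order of
  summation.
\<close>

lemma dual_comult_convolve:
  assumes s: "s \<in> dual_comult A_dual f" and t: "t \<in> dual_comult A_dual e"
    and f: "f \<in> A_dual" and e: "e \<in> A_dual"
  shows "linear_ext (*) (\<lambda>(f1, f2). f1 y * f2 z) (tensor_mult (\<diamondop>) s t) = (f \<diamondop> e) (y * z)"
proof -
  obtain s' t' where s': "s' \<in> \<Delta> y" and t': "t' \<in> \<Delta> z" using comult_obtain by metis
  have keys: "fst p \<in> A_dual" "snd p \<in> A_dual"
    if "p \<in> Poly_Mapping.keys s \<or> p \<in> Poly_Mapping.keys t" for p
    using s t that by (auto simp: dual_comult_def formal_tensors_def)
  have f_mult: "f (p * q) = linear_ext (*) (\<lambda>i. fst i p * snd i q) s"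
    and e_mult: "e (p * q) = linear_ext (*) (\<lambda>i. fst i p * snd i q) t" for p q
    using s t by (auto simp: dual_comult_def case_prod_unfold)
  let ?X = "\<lambda>i j p q. fst i (fst p) * fst j (snd p) * (snd i (fst q) * snd j (snd q))"
  have "linear_ext (*) (\<lambda>(f1, f2). f1 y * f2 z) (tensor_mult (\<diamondop>) s t) =
      linear_ext (*) (\<lambda>i. linear_ext (*) (\<lambda>j. (fst i \<diamondop> fst j) y * (snd i \<diamondop> snd j) z) t) s"
    by (simp add: tensor_mult_eval case_prod_unfold)
  also have "\<dots> = linear_ext (*) (\<lambda>i. linear_ext (*) (\<lambda>j.
      linear_ext (*) (\<lambda>p. linear_ext (*) (\<lambda>q. ?X i j p q) t') s') t) s"
    by (intro linear_ext_cong)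
      (simp add: convolve_apply[OF keys(1) keys(1) s'] convolve_apply[OF keys(2) keys(2) t']
        linear_ext_product)
  also have "\<dots> = linear_ext (*) (\<lambda>p. linear_ext (*) (\<lambda>q.
      linear_ext (*) (\<lambda>i. linear_ext (*) (\<lambda>j. ?X i j p q) t) s) t') s'"
    by (simp only: linear_ext_swap[where t = t and s = s', OF vector_space_field]
        linear_ext_swap[where t = t and s = t', OF vector_space_field]
        linear_ext_swap[where t = s and s = s', OF vector_space_field]
        linear_ext_swap[where t = s and s = t', OF vector_space_field])
  also have "\<dots> = (f \<diamondop> e) (y * z)"
    by (simp add: convolve_apply[OF f e comult_mult[OF _ _ s' t']] tensor_mult_eval f_mult e_mult
        linear_ext_product mult_ac)
  finally show ?thesis .
qed

text \<open>
  If \<open>f(y z) = \<Sum> f\<^sub>1(y) f\<^sub>2(z)\<close>, the antipode axioms of \<open>A\<close> give \<open>\<Sum> (f\<^sub>1 \<circ> S) f\<^sub>2 = f(1) \<epsilon>\<close> and its mirror image.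
\<close>

lemma antipode_convolve:
  assumes t: "t \<in> dual_comult A_dual f" and f: "f \<in> A_dual"
  shows "linear_ext dual_scale (\<lambda>(p, q). dual_antipode S p \<diamondop> q) t = dual_scale (f 1) \<epsilon>"
    and "linear_ext dual_scale (\<lambda>(p, q). p \<diamondop> dual_antipode S q) t = dual_scale (f 1) \<epsilon>"
proof -
  have keys: "fst p \<in> A_dual" "snd p \<in> A_dual" if "p \<in> Poly_Mapping.keys t" for p
    using t that by (auto simp: dual_comult_def formal_tensors_def)
  have f_mult: "f (p * q) = linear_ext (*) (\<lambda>i. fst i p * snd i q) t" for p q
    using t by (auto simp: dual_comult_def case_prod_unfold)
  have "linear_ext dual_scale (\<lambda>(p, q). dual_antipode S p \<diamondop> q) t y = dual_scale (f 1) \<epsilon> y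
    \<and> linear_ext dual_scale (\<lambda>(p, q). p \<diamondop> dual_antipode S q) t y = dual_scale (f 1) \<epsilon> y" for y
  proof
    obtain s where s: "s \<in> \<Delta> y" using comult_obtain .
    have "linear_ext dual_scale (\<lambda>(p, q). dual_antipode S p \<diamondop> q) t y =
      linear_ext (*) (\<lambda>i. linear_ext (*) (\<lambda>p. fst i (S (fst p)) * snd i (snd p)) s) t"
      unfolding linear_ext_dual_apply
      by (intro linear_ext_cong) (simp add: case_prod_unfold keys dual_antipode_def[symmetric]
        convolve_apply[OF linear_functional_antipode _ s]; simp add: dual_antipode_def)
    also have "\<dots> = linear_ext (*) (\<lambda>p. f (S (fst p) * snd p)) s"
      by (simp add: linear_ext_swap[of _ _ s] f_mult)
    also have "\<dots> = f (scale (\<epsilon> y) 1)"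
      by (simp add: antipode_left[OF _ s, symmetric] linear_functionals_linear_ext[OF f] case_prod_unfold)
    finally show "linear_ext dual_scale (\<lambda>(p, q). dual_antipode S p \<diamondop> q) t y = dual_scale (f 1) \<epsilon> y"
      by (simp add: linear_functionalsD[OF f] dual_scale_def mult.commute)
    have "linear_ext dual_scale (\<lambda>(p, q). p \<diamondop> dual_antipode S q) t y =
      linear_ext (*) (\<lambda>i. linear_ext (*) (\<lambda>p. fst i (fst p) * snd i (S (snd p))) s) t"
      unfolding linear_ext_dual_apply
      by (intro linear_ext_cong) (simp add: case_prod_unfold keys dual_antipode_def[symmetric]
        convolve_apply[OF _ linear_functional_antipode s]; simp add: dual_antipode_def)
    also have "\<dots> = linear_ext (*) (\<lambda>p. f (fst p * S (snd p))) s"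
      by (simp add: linear_ext_swap[of _ _ s] f_mult)
    also have "\<dots> = f (scale (\<epsilon> y) 1)"
      by (simp add: antipode_right[OF _ s, symmetric] linear_functionals_linear_ext[OF f] case_prod_unfold)
    finally show "linear_ext dual_scale (\<lambda>(p, q). p \<diamondop> dual_antipode S q) t y = dual_scale (f 1) \<epsilon> y"
      by (simp add: linear_functionalsD[OF f] dual_scale_def mult.commute)
  qed
  then show "linear_ext dual_scale (\<lambda>(p, q). dual_antipode S p \<diamondop> q) t = dual_scale (f 1) \<epsilon>"
    "linear_ext dual_scale (\<lambda>(p, q). p \<diamondop> dual_antipode S q) t = dual_scale (f 1) \<epsilon>"
    by blast+
qed

theorem hopf_algebra_of_functionals:
  assumes H: "functionals.subspace H" "H \<subseteq> A_dual" "\<epsilon> \<in> H"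
    and closed: "\<And>f e. f \<in> H \<Longrightarrow> e \<in> H \<Longrightarrow> f \<diamondop> e \<in> H"
    and comult: "\<And>f. f \<in> H \<Longrightarrow> dual_comult H f \<noteq> {}"
    and antipode: "\<And>f. f \<in> H \<Longrightarrow> dual_antipode S f \<in> H"
  shows "hopf_algebra dual_scale H (\<diamondop>) \<epsilon> (dual_comult H) dual_counit (dual_antipode S)"
proof -
  interpret H: algebra_on dual_scale H "(\<diamondop>)" \<epsilon>
    by (rule algebra_on_functionals) (use assms in auto)
  have formal: "formal_tensors H = {t :: ('a \<Rightarrow> 'k) \<times> ('a \<Rightarrow> 'k) \<Rightarrow>\<^sub>0 'k. Poly_Mapping.keys t \<subseteq> H \<times> H}"
    by (simp add: formal_tensors_def)
  have formal_subspace: "free.subspace (formal_tensors H :: (('a \<Rightarrow> 'k) \<times> ('a \<Rightarrow> 'k) \<Rightarrow>\<^sub>0 'k) set)"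
    unfolding formal by (rule free_subspace_keys)
  have mono: "t \<in> dual_comult A_dual f" if "t \<in> dual_comult H f" for t f
    using dual_comult_mono[OF H(2)] that by blast
  show ?thesis
  proof
    fix f assume "f \<in> H"
    then obtain t where t: "t \<in> dual_comult H f" using comult by blast
    then show "dual_comult H f \<in> tensor_square dual_scale H"
      unfolding tensor_square_def
      using dual_comult_eq_tensor_class[OF H(1) t] by (auto simp: dual_comult_def)
  next
    fix f e s t assume "s \<in> dual_comult H f" "t \<in> dual_comult H e"
    then show "s + t \<in> dual_comult H (f + e)"
      by (auto simp: dual_comult_def intro: free.subspace_add[OF formal_subspace])
  next
    fix f t c assume "t \<in> dual_comult H f"
    then show "free_scale c t \<in> dual_comult H (dual_scale c f)"
      by (auto simp: dual_comult_def dual_scale_def intro: free.subspace_scale[OF formal_subspace])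
  next
    fix f e s t assume fe: "f \<in> H" "e \<in> H" and st: "s \<in> dual_comult H f" "t \<in> dual_comult H e"
    have keys: "fst p \<in> H" "snd p \<in> H"
      if "p \<in> Poly_Mapping.keys s \<or> p \<in> Poly_Mapping.keys t" for p
      using st that by (auto simp: dual_comult_def formal_tensors_def)
    have "tensor_mult (\<diamondop>) s t \<in> formal_tensors H"
      unfolding tensor_mult_def case_prod_unfold
      by (intro linear_ext_free_closed[OF formal_subspace])
        (simp add: formal_tensors_def pure_tensor_def closed keys)
    then show "tensor_mult (\<diamondop>) s t \<in> dual_comult H (f \<diamondop> e)"
      using dual_comult_convolve[OF mono[OF st(1)] mono[OF st(2)]] fe H(2)
      by (auto simp: dual_comult_def)
  next
    show "\<epsilon> \<otimes>\<^sub>f \<epsilon> \<in> dual_comult H \<epsilon>"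
      using H(3) by (auto simp: dual_comult_def formal_tensors_def pure_tensor_def counit_mult)
  next
    fix f t D assume f: "f \<in> H" and t: "t \<in> dual_comult H f" and D: "\<And>p. p \<in> H \<Longrightarrow> D p \<in> dual_comult H p"
    let ?l = "linear_ext free_scale (\<lambda>(p, q).
             linear_ext free_scale (\<lambda>(p1, p2). Poly_Mapping.single (p1, p2, q) 1) (D p)) t"
    let ?r = "linear_ext free_scale (\<lambda>(p, q).
             linear_ext free_scale (\<lambda>(q1, q2). Poly_Mapping.single (p, q1, q2) 1) (D q)) t"
    have keys: "fst p \<in> H" "snd p \<in> H" if "p \<in> Poly_Mapping.keys t" for p
      using t that by (auto simp: dual_comult_def formal_tensors_def)
    have D_keys: "fst p \<in> H" "snd p \<in> H" if "p \<in> Poly_Mapping.keys (D g)" "g \<in> H" for p g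
      using D that by (fastforce simp: dual_comult_def formal_tensors_def)+
    have t_eval: "linear_ext (*) (\<lambda>p. fst p y * snd p z) t = f (y * z)" for y z
      using t by (simp add: dual_comult_def case_prod_unfold)
    have D_eval: "linear_ext (*) (\<lambda>p. fst p y * snd p z) (D g) = g (y * z)" if "g \<in> H" for g y z
      using D[OF that] by (simp add: dual_comult_def case_prod_unfold)
    note closed3 = linear_ext_free_closed[OF free_subspace_keys[of "H \<times> H \<times> H"]]
    show "?l - ?r \<in> tensor3_null dual_scale H"
    proof (rule functional_tensor3_null[OF H(1)])
      have "?l \<in> {t. Poly_Mapping.keys t \<subseteq> H \<times> H \<times> H}" "?r \<in> {t. Poly_Mapping.keys t \<subseteq> H \<times> H \<times> H}"
        unfolding case_prod_unfold
        by (intro closed3; simp add: mem_Times_iff keys D_keys(1)[OF _ keys(1)] D_keys(2)[OF _ keys(1)]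
            D_keys(1)[OF _ keys(2)] D_keys(2)[OF _ keys(2)])+
      then show "Poly_Mapping.keys (?l - ?r) \<subseteq> H \<times> H \<times> H"
        using free.subspace_diff[OF free_subspace_keys] by blast
      fix y z w
      have "linear_ext (*) (\<lambda>(u, v, w'). u y * v z * w' w) ?l
        = linear_ext (*) (\<lambda>p. fst p (y * z) * snd p w) t"
        by (simp add: case_prod_unfold) (intro linear_ext_cong,
            simp add: linear_ext_mult_right[symmetric] D_eval keys)
      moreover have "linear_ext (*) (\<lambda>(u, v, w'). u y * v z * w' w) ?r
        = linear_ext (*) (\<lambda>p. fst p y * snd p (z * w)) t"
        by (simp add: case_prod_unfold mult.assoc) (intro linear_ext_cong,
            simp add: linear_ext_mult_left[symmetric] D_eval keys)
      ultimately show "linear_ext (*) (\<lambda>(u, v, w'). u y * v z * w' w) (?l - ?r) = 0"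
        by (simp add: t_eval mult.assoc)
    qed
  next
    fix f t assume "f \<in> H" and t: "t \<in> dual_comult H f"
    then have f: "f \<in> A_dual" using H(2) by blast
    have t_eval: "linear_ext (*) (\<lambda>p. fst p y * snd p z) t = f (y * z)" for y z
      using t by (simp add: dual_comult_def case_prod_unfold)
    show "linear_ext dual_scale (\<lambda>(p, q). dual_scale (dual_counit p) q) t = f"
      using t_eval[of 1]
      by (auto simp: linear_ext_dual_apply case_prod_unfold dual_counit_def dual_scale_def)
    show "linear_ext dual_scale (\<lambda>(p, q). dual_scale (dual_counit q) p) t = f"
      using t_eval[of _ 1]
      by (auto simp: linear_ext_dual_apply case_prod_unfold dual_counit_def dual_scale_def mult.commute)
    show "linear_ext dual_scale (\<lambda>(p, q). dual_antipode S p \<diamondop> q) t = dual_scale (dual_counit f) \<epsilon>"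
      "linear_ext dual_scale (\<lambda>(p, q). p \<diamondop> dual_antipode S q) t = dual_scale (dual_counit f) \<epsilon>"
      using antipode_convolve[OF mono[OF t] f] by (simp_all add: dual_counit_def)
  next
    fix f e assume "f \<in> H" "e \<in> H"
    then have fe: "f \<in> A_dual" "e \<in> A_dual" using H(2) by auto
    have "1 \<otimes>\<^sub>f 1 \<in> \<Delta> 1" by (rule comult_one)
    then show "dual_counit (f \<diamondop> e) = dual_counit f * dual_counit e"
      using convolve_apply[OF fe] by (simp add: dual_counit_def pure_tensor_def)
  qed (use antipode in \<open>auto simp: H.mult_assoc H.mult_add_left H.mult_add_right
      H.mult_scale_left[unfolded dual_scale_def] H.mult_scale_right[unfolded dual_scale_def]
      H.one_left H.one_right closed H dual_counit_def dual_scale_def counit_one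
      dual_antipode_def\<close>)
qed

end

section \<open>The Hopf algebra A and its eigenfunctionals\<close>

text \<open>
  Square matrices as functions on a finite index type: unlike matrices with a variable size they form
  an additive group, as the evaluation of noncommutative polynomials requires of its target.
\<close>

definition matrix_scale :: "'k::field \<Rightarrow> ('i \<Rightarrow> 'i \<Rightarrow> 'k) \<Rightarrow> ('i \<Rightarrow> 'i \<Rightarrow> 'k)" where
  "matrix_scale c A = (\<lambda>i j. c * A i j)"

definition matrix_mult :: "('i::finite \<Rightarrow> 'i \<Rightarrow> 'k::field) \<Rightarrow> ('i \<Rightarrow> 'i \<Rightarrow> 'k) \<Rightarrow> ('i \<Rightarrow> 'i \<Rightarrow> 'k)" where
  "matrix_mult A B = (\<lambda>i j. \<Sum>k\<in>UNIV. A i k * B k j)"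

definition matrix_one :: "'i \<Rightarrow> 'i \<Rightarrow> 'k::field" where
  "matrix_one = (\<lambda>i j. of_bool (i = j))"

lemma algebra_on_matrix: "algebra_on matrix_scale UNIV matrix_mult matrix_one"
proof
  fix A B C :: "'i::finite \<Rightarrow> 'i \<Rightarrow> 'k::field" and c
  show "matrix_mult (matrix_mult A B) C = matrix_mult A (matrix_mult B C)"
    unfolding matrix_mult_def sum_distrib_left sum_distrib_right
    by (intro ext, subst sum.swap) (simp add: mult.assoc)
  show "module.subspace matrix_scale (UNIV :: ('i \<Rightarrow> 'i \<Rightarrow> 'k) set)"
    by (intro module.subspace_UNIV, unfold_locales)
      (auto simp: matrix_scale_def algebra_simps fun_eq_iff)
qed (auto simp: matrix_scale_def matrix_mult_def matrix_one_def fun_eq_iff algebra_simps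
    sum.distrib sum_distrib_left sum_of_bool_mult_eq sum_mult_of_bool_eq)

locale hopf_A = hopf_ring scale \<Delta> \<epsilon> S
  for scale :: "'k::field_char_0 \<Rightarrow> 'a::ring_1 \<Rightarrow> 'a"
    and \<Delta> :: "'a \<Rightarrow> ('a \<times> 'a \<Rightarrow>\<^sub>0 'k) set"
    and \<epsilon> :: "'a \<Rightarrow> 'k"
    and S :: "'a \<Rightarrow> 'a" +
  fixes g h :: 'a
  assumes presentation_A: "presented_by scale UNIV (*) 1 (case_gen_A g h) relations_A"
    and comult_g: "\<Delta> g = tensor_class scale UNIV (g \<otimes>\<^sub>f g)"
    and comult_h: "\<Delta> h = tensor_class scale UNIV ((g \<otimes>\<^sub>f h) + (h \<otimes>\<^sub>f 1))"
begin

lemma relation_eval: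
  assumes "r \<in> relations_A"
  shows "eval_free scale (*) 1 (case_gen_A g h) r = 0"
proof -
  have "r \<in> ideal_generated relations_A"
    using assms unfolding ideal_generated_def by blast
  then show ?thesis using presentation_A unfolding presented_by_def by blast
qed

lemma g_g: "g * g = 1" and gh: "g * h = - (h * g)"
proof -
  have gen: "range (case_gen_A g h) \<subseteq> UNIV" by simp
  note simps = algebra.eval_free_simps[OF gen]
  have "eval_free scale (*) 1 (case_gen_A g h) (var Gen_g ^ 2 - 1) = 0"
    by (rule relation_eval) (simp add: relations_A_def)
  then show "g * g = 1" by (simp add: simps numeral_2_eq_2)
  have "eval_free scale (*) 1 (case_gen_A g h) (var Gen_g * var Gen_h + var Gen_h * var Gen_g) = 0"
    by (rule relation_eval) (simp add: relations_A_def)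
  then show "g * h = - (h * g)" by (simp add: simps eq_neg_iff_add_eq_0)
qed

lemma g_g_left: "g * (g * y) = y"
  by (simp add: mult.assoc[symmetric] g_g)

lemma h_g_left: "h * (g * y) = - (g * (h * y))"
  by (simp add: mult.assoc[symmetric] gh)

text \<open>
  \<open>A\<close> is spanned by the words in \<open>g\<close> and \<open>h\<close>, whose letters are peeled off from the left.
\<close>

lemma A_induct [case_names one g h add scale]:
  assumes "P 1" "\<And>y. P y \<Longrightarrow> P (g * y)" "\<And>y. P y \<Longrightarrow> P (h * y)"
    and "\<And>y z. P y \<Longrightarrow> P z \<Longrightarrow> P (y + z)" "\<And>c y. P y \<Longrightarrow> P (scale c y)"
  shows "P y"
proof -
  have words: "P (foldr (\<lambda>i. (*) (case_gen_A g h i)) w 1)" for w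
  proof (induction w)
    case (Cons i w)
    then show ?case by (cases i) (simp_all add: assms)
  qed (simp add: assms)
  have zero: "P 0" using assms(5)[OF assms(1), of 0] by simp
  obtain p where "y = eval_free scale (*) 1 (case_gen_A g h) p"
    using presentation_A unfolding presented_by_def by blast
  moreover have "P (\<Sum>w\<in>K. scale (c w) (foldr (\<lambda>i. (*) (case_gen_A g h i)) (letters w) 1))"
    for K and c :: "gen_A free_monoid \<Rightarrow> 'k"
    by (induction K rule: infinite_finite_induct) (simp_all add: zero assms words)
  ultimately show ?thesis by (simp add: eval_free_def linear_ext_def)
qed

lemma h2_central: "h * (h * y) = y * (h * h)"
proof (induction y rule: A_induct)
  case (g y)
  have "h * (h * (g * y)) = g * (h * (h * y))"
    by (simp add: h_g_left)
  then show ?case using g by (simp add: mult.assoc)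
qed (simp_all add: mult.assoc distrib_left distrib_right mult_scale_left mult_scale_right)

lemma comult_g_mem: "g \<otimes>\<^sub>f g \<in> \<Delta> g"
  by (simp add: comult_g tensor_class_def formal_tensors_def tensor2_null_def free.span_zero)

lemma comult_h_mem: "(g \<otimes>\<^sub>f h) + (h \<otimes>\<^sub>f 1) \<in> \<Delta> h"
  by (simp add: comult_h tensor_class_def formal_tensors_def tensor2_null_def free.span_zero)

lemma counit_g: "\<epsilon> g = 1"
proof -
  have "scale (\<epsilon> g) g = g"
    using counit_left[OF UNIV_I comult_g_mem] by (simp add: pure_tensor_def)
  then have "scale (\<epsilon> g) 1 = 1"
    using mult_scale_right[of g g "\<epsilon> g"] by (simp add: g_g)
  then have "scale (\<epsilon> g - 1) 1 = 0" by (simp add: scale_left_diff_distrib)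
  then show ?thesis by simp
qed

lemma counit_h: "\<epsilon> h = 0"
  using counit_left[OF UNIV_I comult_h_mem] by (simp add: pure_tensor_def counit_g)

text \<open>
  The condition \<open>f(h\<^sup>2 y) = n f(y)\<close> is written with \<open>h * (h * y)\<close>, the form in which the recursion for
  convolutions produces it.
\<close>

definition eigenfunctionals :: "'k \<Rightarrow> 'k \<Rightarrow> ('a \<Rightarrow> 'k) set" where
  "eigenfunctionals s n =
     {f \<in> A_dual. \<forall>y. f (g * y) = s * f y \<and> f (h * (h * y)) = n * f y}"

lemma eigenfunctionalsD:
  assumes "f \<in> eigenfunctionals s n"
  shows "f \<in> A_dual" "f (g * y) = s * f y" "f (h * (h * y)) = n * f y"
  using assms by (simp_all add: eigenfunctionals_def)

lemma linear_functional_minus: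
  assumes "f \<in> A_dual"
  shows "f (- y) = - f y" "f 0 = 0"
  using linear_functionalsD(2)[OF assms, of "-1" y] linear_functionalsD(2)[OF assms, of 0 y] by simp_all

lemma eigenfunctional_h:
  assumes "f \<in> eigenfunctionals s n"
  shows "(\<lambda>y. f (h * y)) \<in> eigenfunctionals (- s) n"
  using eigenfunctionalsD[OF assms]
  by (simp add: eigenfunctionals_def linear_functionals_def distrib_left mult_scale_right
      h_g_left linear_functional_minus)

lemma eigenfunctional_right:
  assumes "f \<in> eigenfunctionals s n"
  shows "(\<lambda>y. f (y * z)) \<in> eigenfunctionals s n"
  using eigenfunctionalsD[OF assms]
  by (simp add: eigenfunctionals_def linear_functionals_def distrib_right mult_scale_left mult.assoc)

lemma subspace_eigenfunctionals: "functionals.subspace (eigenfunctionals s n)"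
  by (rule functionals.subspaceI)
    (auto simp: eigenfunctionals_def linear_functionals_def dual_scale_def algebra_simps)

text \<open>
  As \<open>hg = -gh\<close>, every word is \<open>\<plusminus>g\<^sup>i h\<^sup>j\<close>, and the eigenvalue equations reduce its value to one
  at \<open>1\<close> or \<open>h\<close>.
\<close>

lemma eigenfunctional_zero:
  assumes f: "f \<in> eigenfunctionals s n" and "f 1 = 0" "f h = 0"
  shows "f = 0"
proof
  note f_lin = linear_functionalsD[OF eigenfunctionalsD(1)[OF f]]
    linear_functional_minus[OF eigenfunctionalsD(1)[OF f]]
  have "f y = 0 \<and> f (h * y) = 0" for y
    by (induction y rule: A_induct)
      (simp_all add: assms eigenfunctionalsD[OF f] f_lin h_g_left distrib_left mult_scale_right)
  then show "f y = 0 y" for y by simp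
qed

lemma eigenfunctional_eqI:
  assumes "f \<in> eigenfunctionals s n" "e \<in> eigenfunctionals s n" "f 1 = e 1" "f h = e h"
  shows "f = e"
proof -
  have "f - e = 0"
    by (rule eigenfunctional_zero[OF functionals.subspace_diff[OF subspace_eigenfunctionals assms(1,2)]])
      (use assms in simp_all)
  then show ?thesis by simp
qed

text \<open>
  The representation \<open>g \<mapsto> diag(s, -s)\<close>, \<open>h \<mapsto> (0 n; 1 0)\<close> on two basis vectors, of which \<open>False\<close> is the
  first; here \<open>h\<^sup>2\<close> acts as the scalar \<open>n\<close>.
\<close>

definition two_dim_rep :: "'k \<Rightarrow> 'k \<Rightarrow> ('a \<Rightarrow> bool \<Rightarrow> bool \<Rightarrow> 'k) \<Rightarrow> bool" where
  "two_dim_rep s n R \<longleftrightarrow>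
     R 1 = matrix_one \<and> (\<forall>y z. R (y * z) = matrix_mult (R y) (R z)) \<and>
     (\<forall>y z. R (y + z) = R y + R z) \<and> (\<forall>c y. R (scale c y) = matrix_scale c (R y)) \<and>
     R g = (\<lambda>i j. if i \<noteq> j then 0 else if i then - s else s) \<and>
     R h = (\<lambda>i j. if i = j then 0 else if j then n else 1)"

lemma two_dim_repD:
  assumes "two_dim_rep s n R"
  shows "R 1 = matrix_one" "R (y * z) = matrix_mult (R y) (R z)" "R (y + z) = R y + R z"
    "R (scale c y) = matrix_scale c (R y)"
    "R g = (\<lambda>i j. if i \<noteq> j then 0 else if i then - s else s)"
    "R h = (\<lambda>i j. if i = j then 0 else if j then n else 1)"
  using assms unfolding two_dim_rep_def by blast+

lemma two_dim_rep_exists: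
  assumes s: "s * s = 1"
  obtains R where "two_dim_rep s n R"
proof -
  interpret M: algebra_on matrix_scale UNIV matrix_mult
    "matrix_one :: bool \<Rightarrow> bool \<Rightarrow> 'k" by (rule algebra_on_matrix)
  define G :: "bool \<Rightarrow> bool \<Rightarrow> 'k" where "G = (\<lambda>i j. if i \<noteq> j then 0 else if i then - s else s)"
  define M :: "bool \<Rightarrow> bool \<Rightarrow> 'k" where "M = (\<lambda>i j. if i = j then 0 else if j then n else 1)"
  have GM: "matrix_mult G G = matrix_one" "matrix_mult G M + matrix_mult M G = 0"
    using s by (auto simp: matrix_mult_def matrix_one_def fun_eq_iff UNIV_bool G_def M_def)
  have gen: "range (case_gen_A G M) \<subseteq> UNIV" by simp
  have "eval_free matrix_scale matrix_mult matrix_one (case_gen_A G M) r = 0"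
    if "r \<in> relations_A" for r
    using that GM unfolding relations_A_def
    by (auto simp: M.eval_free_simps[OF gen] M.one_right numeral_2_eq_2)
  from algebra.presented_by_hom_exists[OF presentation_A M.algebra_on_axioms gen this]
  obtain R where R: "R 1 = matrix_one" "\<And>y z. R (y * z) = matrix_mult (R y) (R z)"
    "\<And>y z. R (y + z) = R y + R z" "\<And>c y. R (scale c y) = matrix_scale c (R y)"
    "\<And>i. R (case_gen_A g h i) = case_gen_A G M i"
    by auto
  show thesis
    by (rule that[of R])
      (use R R(5)[of Gen_g] R(5)[of Gen_h] in \<open>simp add: two_dim_rep_def G_def M_def\<close>)
qed

text \<open>
  Left multiplication by \<open>g\<close> scales a row of the representing matrix, so the type of an entry depends
  only on its row.
\<close>

lemma two_dim_rep_entry: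
  assumes "two_dim_rep s n R"
  shows "(\<lambda>y. R y i j) \<in> eigenfunctionals (if i then - s else s) n"
  using two_dim_repD[OF assms]
  by (cases i) (simp_all add: eigenfunctionals_def linear_functionals_def matrix_scale_def
      matrix_mult_def UNIV_bool)

definition even_functional :: "'k \<Rightarrow> 'k \<Rightarrow> ('a \<Rightarrow> 'k)" where
  "even_functional s n = (THE f. f \<in> eigenfunctionals s n \<and> f 1 = 1 \<and> f h = 0)"

definition odd_functional :: "'k \<Rightarrow> 'k \<Rightarrow> ('a \<Rightarrow> 'k)" where
  "odd_functional s n = (THE f. f \<in> eigenfunctionals s n \<and> f 1 = 0 \<and> f h = 1)"

lemma even_functionalI:
  "f \<in> eigenfunctionals s n \<Longrightarrow> f 1 = 1 \<Longrightarrow> f h = 0 \<Longrightarrow> even_functional s n = f"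
  unfolding even_functional_def by (rule the_equality) (auto intro: eigenfunctional_eqI)

lemma odd_functionalI:
  "f \<in> eigenfunctionals s n \<Longrightarrow> f 1 = 0 \<Longrightarrow> f h = 1 \<Longrightarrow> odd_functional s n = f"
  unfolding odd_functional_def by (rule the_equality) (auto intro: eigenfunctional_eqI)

lemma even_functional_entry:
  assumes "two_dim_rep s n R"
  shows "even_functional s n = (\<lambda>y. R y False False)"
  using two_dim_rep_entry[OF assms, of False False] two_dim_repD[OF assms]
  by (intro even_functionalI) (simp_all add: matrix_one_def)

lemma odd_functional_entry:
  assumes "two_dim_rep (- s) n R"
  shows "odd_functional s n = (\<lambda>y. R y True False)"
  using two_dim_rep_entry[OF assms, of True False] two_dim_repD[OF assms]
  by (intro odd_functionalI) (simp_all add: matrix_one_def)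

lemma even_functional:
  assumes s: "s * s = 1"
  shows "even_functional s n \<in> eigenfunctionals s n" "even_functional s n 1 = 1" "even_functional s n h = 0"
proof -
  obtain R where R: "two_dim_rep s n R" using two_dim_rep_exists[OF s] .
  show "even_functional s n \<in> eigenfunctionals s n" "even_functional s n 1 = 1"
    "even_functional s n h = 0"
    using two_dim_rep_entry[OF R, of False False] two_dim_repD[OF R]
    by (simp_all add: even_functional_entry[OF R] matrix_one_def)
qed

lemma odd_functional:
  assumes s: "s * s = 1"
  shows "odd_functional s n \<in> eigenfunctionals s n" "odd_functional s n 1 = 0" "odd_functional s n h = 1"
proof -
  have "(- s) * (- s) = 1" using s by simp
  then obtain R where R: "two_dim_rep (- s) n R" by (rule two_dim_rep_exists)
  show "odd_functional s n \<in> eigenfunctionals s n" "odd_functional s n 1 = 0"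
    "odd_functional s n h = 1"
    using two_dim_rep_entry[OF R, of True False] two_dim_repD[OF R]
    by (simp_all add: odd_functional_entry[OF R] matrix_one_def)
qed

lemma eigenfunctional_decompose:
  assumes "s * s = 1" "f \<in> eigenfunctionals s n"
  shows "f = dual_scale (f 1) (even_functional s n) + dual_scale (f h) (odd_functional s n)"
  by (rule eigenfunctional_eqI[OF assms(2)
        functionals.subspace_add[OF subspace_eigenfunctionals
          functionals.subspace_scale[OF subspace_eigenfunctionals even_functional(1)]
          functionals.subspace_scale[OF subspace_eigenfunctionals odd_functional(1)]]])
    (simp_all add: assms dual_scale_def even_functional odd_functional)

text \<open>
  This and the next lemma say that \<open>(even s n, n odd s n; odd (-s) n, even (-s) n)\<close> is a matrix
  representation.  For fixed \<open>z\<close> the functional \<open>y \<mapsto> f(y z)\<close> is again an eigenfunctional, with values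
  \<open>f(z)\<close> at \<open>1\<close> and \<open>f(h z)\<close> at \<open>h\<close>, and \<open>z \<mapsto> f(h z)\<close> is one of the opposite sign.
\<close>

lemma even_functional_mult:
  assumes s: "s * s = 1"
  shows "even_functional s n (y * z) = even_functional s n y * even_functional s n z
    + n * (odd_functional s n y * odd_functional (- s) n z)"
proof -
  note ev = even_functional[OF s, of n]
  have s': "(- s) * (- s) = 1" using s by simp
  have "(\<lambda>y. even_functional s n (h * y)) = dual_scale n (odd_functional (- s) n)"
    by (subst eigenfunctional_decompose[OF s' eigenfunctional_h[OF ev(1)]])
      (use eigenfunctionalsD(3)[OF ev(1), of 1] in \<open>simp add: ev\<close>)
  moreover have "even_functional s n (y * z)
      = even_functional s n z * even_functional s n y + even_functional s n (h * z) * odd_functional s n y"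
    using fun_cong[OF eigenfunctional_decompose[OF s eigenfunctional_right[OF ev(1), of z]], of y]
    by (simp add: dual_scale_def)
  ultimately show ?thesis by (simp add: dual_scale_def fun_eq_iff mult.commute mult.left_commute)
qed

lemma odd_functional_mult:
  assumes s: "s * s = 1"
  shows "odd_functional s n (y * z) = even_functional s n y * odd_functional s n z
    + odd_functional s n y * even_functional (- s) n z"
proof -
  note od = odd_functional[OF s, of n]
  have s': "(- s) * (- s) = 1" using s by simp
  have "(\<lambda>y. odd_functional s n (h * y)) = even_functional (- s) n"
    by (subst eigenfunctional_decompose[OF s' eigenfunctional_h[OF od(1)]])
      (use eigenfunctionalsD(3)[OF od(1), of 1] in \<open>simp add: od\<close>)
  moreover have "odd_functional s n (y * z)
      = odd_functional s n z * even_functional s n y + odd_functional s n (h * z) * odd_functional s n y"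
    using fun_cong[OF eigenfunctional_decompose[OF s eigenfunctional_right[OF od(1), of z]], of y]
    by (simp add: dual_scale_def)
  ultimately show ?thesis by (simp add: fun_eq_iff mult.commute)
qed

sublocale full_dual: algebra_on dual_scale A_dual "(\<diamondop>)" \<epsilon>
  by (rule algebra_on_functionals)
    (simp_all add: subspace_linear_functionals counit_functional convolve_closed)

lemma convolve_h:
  assumes f: "f \<in> eigenfunctionals s m" and e: "e \<in> A_dual"
  shows "(f \<diamondop> e) (h * y) = s * (f \<diamondop> (\<lambda>y. e (h * y))) y + ((\<lambda>y. f (h * y)) \<diamondop> e) y"
proof -
  have "(\<lambda>y. f (g * y)) = dual_scale s f"
    by (simp add: eigenfunctionalsD[OF f] dual_scale_def)
  moreover have "(\<lambda>y. e (h * y)) \<in> A_dual"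
    using e by (simp add: linear_functionals_def distrib_left mult_scale_right)
  ultimately show ?thesis
    using convolve_translate[OF eigenfunctionalsD(1)[OF f] e comult_h_mem]
      full_dual.mult_scale_left[OF eigenfunctionalsD(1)[OF f]]
    by (simp add: pure_tensor_def dual_scale_def)
qed

text \<open>
  The eigenvalues of \<open>h\<^sup>2\<close> add up because \<open>h\<^sup>2\<close> is primitive: in the recursion the two mixed terms
  \<open>f(h \<cdot>) e(h \<cdot>)\<close> occur with opposite signs.
\<close>

lemma convolve_eigenfunctionals:
  assumes s: "s * s = 1" and f: "f \<in> eigenfunctionals s m" and e: "e \<in> eigenfunctionals t n"
  shows "f \<diamondop> e \<in> eigenfunctionals (s * t) (m + n)"
    and "(f \<diamondop> e) 1 = f 1 * e 1"
    and "(f \<diamondop> e) h = s * f 1 * e h + f h * e 1"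
proof -
  note f' = eigenfunctionalsD[OF f] and e' = eigenfunctionalsD[OF e]
  note fh = eigenfunctional_h[OF f] and eh = eigenfunctional_h[OF e]
  have shift_f: "(\<lambda>y. f (g * y)) = dual_scale s f" "(\<lambda>y. f (h * (h * y))) = dual_scale m f"
    and shift_e: "(\<lambda>y. e (g * y)) = dual_scale t e" "(\<lambda>y. e (h * (h * y))) = dual_scale n e"
    by (simp_all add: f' e' dual_scale_def)
  have "dual_scale s f \<diamondop> dual_scale t e = dual_scale (s * t) (f \<diamondop> e)"
    using f'(1) e'(1)
    by (simp add: full_dual.mult_scale_left full_dual.mult_scale_right
        functionals.subspace_scale[OF subspace_linear_functionals])
  then have gy: "(f \<diamondop> e) (g * y) = s * t * (f \<diamondop> e) y" for y
    using convolve_translate[OF f'(1) e'(1) comult_g_mem]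
    by (simp add: pure_tensor_def shift_f shift_e) (simp add: dual_scale_def)
  have "(f \<diamondop> e) (h * (h * y)) = (s * s) * (f \<diamondop> dual_scale n e) y + (dual_scale m f \<diamondop> e) y" for y
    using convolve_h[OF f e'(1)] convolve_h[OF f eigenfunctionalsD(1)[OF eh]] convolve_h[OF fh e'(1)]
    by (simp add: shift_f shift_e algebra_simps)
  then have hy: "(f \<diamondop> e) (h * (h * y)) = (m + n) * (f \<diamondop> e) y" for y
    by (simp add: s full_dual.mult_scale_left full_dual.mult_scale_right f' e' algebra_simps)
      (simp add: dual_scale_def algebra_simps)
  show "f \<diamondop> e \<in> eigenfunctionals (s * t) (m + n)"
    by (simp add: eigenfunctionals_def gy hy convolve_closed f' e')
  have at_1: "(f \<diamondop> e) 1 = f 1 * e 1" if "f \<in> A_dual" "e \<in> A_dual" for f e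
    using convolve_apply[OF that comult_one] by (simp add: pure_tensor_def)
  show "(f \<diamondop> e) 1 = f 1 * e 1" using f'(1) e'(1) by (rule at_1)
  show "(f \<diamondop> e) h = s * f 1 * e h + f h * e 1"
    using convolve_h[OF f e'(1), of 1] at_1 fh eh f' e' by (simp add: eigenfunctionalsD)
qed

lemma convolve_basis:
  assumes s: "s * s = 1" and t: "t * t = 1"
  shows "even_functional s m \<diamondop> even_functional t n = even_functional (s * t) (m + n)"
    and "even_functional s m \<diamondop> odd_functional t n = dual_scale s (odd_functional (s * t) (m + n))"
    and "odd_functional s m \<diamondop> even_functional t n = odd_functional (s * t) (m + n)"
    and "odd_functional s m \<diamondop> odd_functional t n = 0"
proof -
  have st: "(s * t) * (s * t) = 1" using s t by (metis mult.assoc mult.left_commute mult_1)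
  note facts = even_functional[OF s] even_functional[OF t] odd_functional[OF s] odd_functional[OF t]
  have decompose: "f \<diamondop> e = dual_scale (f 1 * e 1) (even_functional (s * t) (m + n)) +
      dual_scale (s * f 1 * e h + f h * e 1) (odd_functional (s * t) (m + n))"
    if "f \<in> eigenfunctionals s m" "e \<in> eigenfunctionals t n" for f e
    using eigenfunctional_decompose[OF st convolve_eigenfunctionals(1)[OF s that]]
    by (simp add: convolve_eigenfunctionals[OF s that])
  show "even_functional s m \<diamondop> even_functional t n = even_functional (s * t) (m + n)"
    "even_functional s m \<diamondop> odd_functional t n = dual_scale s (odd_functional (s * t) (m + n))"
    "odd_functional s m \<diamondop> even_functional t n = odd_functional (s * t) (m + n)"
    "odd_functional s m \<diamondop> odd_functional t n = 0"
    using decompose facts by simp_all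
qed

lemma counit_eq_even: "\<epsilon> = even_functional 1 0"
  by (rule even_functionalI[symmetric])
    (simp_all add: eigenfunctionals_def counit_functional counit_mult counit_g counit_h counit_one)

lemma even_comult:
  assumes s: "s * s = 1" and K: "functionals.subspace K" "even_functional s n \<in> K"
    "odd_functional s n \<in> K" "odd_functional (- s) n \<in> K"
  shows "(even_functional s n \<otimes>\<^sub>f even_functional s n)
     + (dual_scale n (odd_functional s n) \<otimes>\<^sub>f odd_functional (- s) n)
     \<in> dual_comult K (even_functional s n)"
  using K functionals.subspace_scale[OF K(1) K(3), of n]
    keys_add[of "even_functional s n \<otimes>\<^sub>f even_functional s n"
      "dual_scale n (odd_functional s n) \<otimes>\<^sub>f odd_functional (- s) n"]
  by (auto simp: dual_comult_def formal_tensors_def pure_tensor_def even_functional_mult[OF s]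
      dual_scale_def mult.assoc)

lemma odd_comult:
  assumes s: "s * s = 1" and K: "even_functional s n \<in> K" "odd_functional s n \<in> K"
    "even_functional (- s) n \<in> K"
  shows "(even_functional s n \<otimes>\<^sub>f odd_functional s n) + (odd_functional s n \<otimes>\<^sub>f even_functional (- s) n)
     \<in> dual_comult K (odd_functional s n)"
  using K keys_add[of "even_functional s n \<otimes>\<^sub>f odd_functional s n"
      "odd_functional s n \<otimes>\<^sub>f even_functional (- s) n"]
  by (auto simp: dual_comult_def formal_tensors_def pure_tensor_def odd_functional_mult[OF s])

text \<open>
  Write \<open>f\<close>, \<open>o\<close> for the even and odd functional of type \<open>(s, n)\<close>, and \<open>f'\<close>, \<open>o'\<close> for those of type \<open>(-s, n)\<close>.
  The antipode axiom gives \<open>S(f) f + n S(o) o' = \<epsilon>\<close> and \<open>S(f) o + S(o) f' = 0\<close>.  As \<open>f'\<close> is invertible, the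
  second equation expresses \<open>S(o)\<close> as \<open>-S(f)\<close> times an odd functional; products of odd functionals are
  \<open>0\<close>, so the first one becomes \<open>S(f) f = \<epsilon>\<close>, and \<open>S(f)\<close> is the inverse of \<open>f\<close>.
\<close>

lemma antipode_basis:
  assumes s: "s * s = 1"
  shows "dual_antipode S (even_functional s n) = even_functional s (- n)"
    and "dual_antipode S (odd_functional s n) = dual_scale (- s) (odd_functional (- s) (- n))"
proof -
  have s': "(- s) * (- s) = 1" using s by simp
  let ?ev = even_functional and ?od = odd_functional and ?S = "dual_antipode S"
  note ev = even_functional[OF s] and od = odd_functional[OF s]
    and ev' = even_functional[OF s'] and od' = odd_functional[OF s']
    and x = odd_functional[of "-1", simplified]
  have dual: "?ev s m \<in> A_dual" "?od s m \<in> A_dual" "?ev (- s) m \<in> A_dual" "?od (- s) m \<in> A_dual"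
    "?od (- 1) m \<in> A_dual" for m
    using ev(1) od(1) ev'(1) od'(1) x(1) eigenfunctionalsD(1) by blast+
  note closed = dual linear_functional_antipode full_dual.mult_closed
  have S_scale: "?S (dual_scale c f) = dual_scale c (?S f)" for c f
    by (simp add: dual_antipode_def dual_scale_def fun_eq_iff)
  have conv_even: "?S (?ev s n) \<diamondop> ?ev s n + dual_scale n (?S (?od s n) \<diamondop> ?od (- s) n) = \<epsilon>"
    using antipode_convolve(1)[OF even_comult[OF s subspace_linear_functionals]] dual
    by (simp add: pure_tensor_def ev S_scale full_dual.mult_scale_left closed)
  have conv_odd: "?S (?ev s n) \<diamondop> ?od s n + ?S (?od s n) \<diamondop> ?ev (- s) n = 0"
    using antipode_convolve(1)[OF odd_comult[OF s]] dual by (simp add: pure_tensor_def od)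
  \<comment> \<open>Cancel the invertible factor \<open>f'\<close> in the second equation.\<close>
  have "?S (?od s n) = ?S (?od s n) \<diamondop> (?ev (- s) n \<diamondop> ?ev (- s) (- n))"
    by (simp add: convolve_basis[OF s' s'] s counit_eq_even[symmetric] full_dual.one_right closed)
  also have "\<dots> = ?S (?od s n) \<diamondop> ?ev (- s) n \<diamondop> ?ev (- s) (- n)"
    by (simp add: full_dual.mult_assoc closed)
  also have "?S (?od s n) \<diamondop> ?ev (- s) n = dual_scale (- 1) (?S (?ev s n) \<diamondop> ?od s n)"
    using conv_odd by (simp add: eq_neg_iff_add_eq_0 add.commute)
  also have "\<dots> \<diamondop> ?ev (- s) (- n) = dual_scale (- 1) (?S (?ev s n) \<diamondop> ?od (- 1) 0)"
    by (simp add: full_dual.mult_scale_left full_dual.mult_assoc closed convolve_basis[OF s s'] s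
        del: functionals.scale_minus_left)
  finally have odd: "?S (?od s n) = dual_scale (- 1) (?S (?ev s n) \<diamondop> ?od (- 1) 0)" .
  have "?S (?od s n) \<diamondop> ?od (- s) n = 0"
    unfolding odd using convolve_basis(4)[of "-1" "- s" 0 n] s'
    by (simp add: full_dual.mult_scale_left full_dual.mult_assoc closed
        del: functionals.scale_minus_left)
  with conv_even have inverse: "?S (?ev s n) \<diamondop> ?ev s n = \<epsilon>" by simp
  have "?S (?ev s n) = ?S (?ev s n) \<diamondop> (?ev s n \<diamondop> ?ev s (- n))"
    by (simp add: convolve_basis[OF s s] s counit_eq_even[symmetric] full_dual.one_right closed)
  also have "\<dots> = \<epsilon> \<diamondop> ?ev s (- n)"
    by (simp add: full_dual.mult_assoc[symmetric] closed inverse)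
  finally show even: "?S (?ev s n) = ?ev s (- n)"
    by (simp add: full_dual.one_left closed)
  show "?S (?od s n) = dual_scale (- s) (?od (- s) (- n))"
    unfolding odd even using convolve_basis(2)[OF s, of "-1" "- n" 0] by simp
qed

end

section \<open>The reconstructed Hopf algebra\<close>

lemma scalar_prod_mult_mat_vec_columns:
  fixes B :: "'k::field mat"
  assumes "B \<in> carrier_mat n n" "\<xi> \<in> carrier_vec n" "w \<in> carrier_vec n"
  shows "\<xi> \<bullet> (B *\<^sub>v w) = (\<Sum>l<n. w $ l * (\<xi> \<bullet> col B l))"
proof -
  have "\<xi> \<bullet> (B *\<^sub>v w) = (\<Sum>i<n. \<Sum>l<n. \<xi> $ i * (B $$ (i, l) * w $ l))"
    using assms by (simp add: scalar_prod_def mult_mat_vec_def sum_distrib_left lessThan_atLeast0)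
  also have "\<dots> = (\<Sum>l<n. \<Sum>i<n. \<xi> $ i * (B $$ (i, l) * w $ l))" by (rule sum.swap)
  also have "\<dots> = (\<Sum>l<n. w $ l * (\<xi> \<bullet> col B l))"
    using assms by (intro sum.cong refl)
      (simp add: scalar_prod_def sum_distrib_left lessThan_atLeast0 mult_ac)
  finally show ?thesis .
qed

lemma smult_mat_mult_vec:
  fixes A :: "'k::field mat"
  assumes "A \<in> carrier_mat n n'" "v \<in> carrier_vec n'"
  shows "(c \<cdot>\<^sub>m A) *\<^sub>v v = c \<cdot>\<^sub>v (A *\<^sub>v v)"
  using assms by (intro eq_vecI) (auto simp: scalar_prod_def sum_distrib_left mult.assoc)

lemma mult_mat_vec_col:
  fixes A B :: "'k::field mat"
  assumes "A \<in> carrier_mat n n" "B \<in> carrier_mat n n" "l < n"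
  shows "A *\<^sub>v col B l = col (A * B) l"
  using assms by (intro eq_vecI) auto

lemma col_diagonal:
  fixes P D :: "'k::field mat"
  assumes "P \<in> carrier_mat n n" "D \<in> carrier_mat n n" "diagonal_mat D" "l < n"
  shows "col (P * D) l = D $$ (l, l) \<cdot>\<^sub>v col P l"
proof (rule eq_vecI)
  fix i assume "i < dim_vec (D $$ (l, l) \<cdot>\<^sub>v col P l)"
  then have i: "i < n" using assms by simp
  have "row P i \<bullet> col D l = (\<Sum>j<n. P $$ (i, j) * D $$ (j, l))"
    using assms i by (simp add: scalar_prod_def lessThan_atLeast0)
  also have "\<dots> = (\<Sum>j<n. if j = l then P $$ (i, l) * D $$ (l, l) else 0)"
    using assms by (intro sum.cong refl) (auto simp: diagonal_mat_def)
  finally show "col (P * D) l $ i = (D $$ (l, l) \<cdot>\<^sub>v col P l) $ i"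
    using assms i by (simp add: mult.commute)
qed (use assms in simp)

context hopf_A
begin

definition integral_eigenfunctionals :: "('a \<Rightarrow> 'k) set" where
  "integral_eigenfunctionals = (\<Union>s\<in>{1, - 1}. \<Union>n\<in>\<int>. eigenfunctionals s n)"

text \<open>
  The two summands \<open>f(y) \<plusminus> f(g y)\<close> of \<open>2 f\<close> are eigenfunctionals of sign \<open>\<plusminus>1\<close>.
\<close>

lemma eigenfunctional_split:
  assumes f: "f \<in> A_dual" and n: "\<And>y. f (h * (h * y)) = n * f y" "n \<in> \<int>"
  shows "f \<in> functionals.span integral_eigenfunctionals"
proof -
  note f_lin = linear_functionalsD[OF f]
  define f' where "f' c = (\<lambda>y. f y + c * f (g * y))" for c
  have "h * (h * (g * y)) = g * (h * (h * y))" for y by (simp add: h_g_left)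
  then have hhg: "f (g * (h * (h * y))) = n * f (g * y)" for y by (metis n(1))
  have "f' s \<in> eigenfunctionals s n" if "s * s = 1" for s
    using that by (simp add: eigenfunctionals_def f'_def linear_functionals_def f_lin distrib_left
        mult_scale_right n hhg g_g_left algebra_simps)
  from this[of 1] this[of "-1"] have "f' 1 \<in> integral_eigenfunctionals" "f' (- 1) \<in> integral_eigenfunctionals"
    unfolding integral_eigenfunctionals_def using n(2) by auto
  then have "dual_scale (1/2) (f' 1) + dual_scale (1/2) (f' (- 1))
      \<in> functionals.span integral_eigenfunctionals"
    by (intro functionals.span_add functionals.span_scale functionals.span_base)
  also have "dual_scale (1/2) (f' 1) + dual_scale (1/2) (f' (- 1)) = f"
    by (simp add: f'_def dual_scale_def fun_eq_iff field_simps)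
  finally show ?thesis .
qed

text \<open>
  If \<open>\<rho>(h\<^sup>2) = P D P\<^sup>-\<^sup>1\<close> with \<open>D\<close> diagonal, the columns of \<open>P\<close> are eigenvectors of \<open>h\<^sup>2\<close>.  Expanding the vector
  \<open>v\<close> in these columns writes a matrix coefficient as a combination of the coefficients \<open>c\<^sub>l\<close> of
  eigenvectors, for which \<open>c\<^sub>l(h\<^sup>2 y) = D\<^sub>l\<^sub>l c\<^sub>l(y)\<close> by centrality of \<open>h\<^sup>2\<close>.
\<close>

lemma matrix_coefficient_in_span:
  assumes X: "(n, \<rho>) \<in> category_C scale h" and \<xi>: "\<xi> \<in> carrier_vec n" and v: "v \<in> carrier_vec n"
  shows "(\<lambda>y. \<xi> \<bullet> (\<rho> y *\<^sub>v v)) \<in> functionals.span integral_eigenfunctionals"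
proof -
  have \<rho>: "\<rho> y \<in> carrier_mat n n" "\<rho> 1 = 1\<^sub>m n" "\<rho> (y * z) = \<rho> y * \<rho> z"
      "\<rho> (y + z) = \<rho> y + \<rho> z" "\<rho> (scale c y) = c \<cdot>\<^sub>m \<rho> y" for y z c
    using X unfolding category_C_def left_module_def mem_Collect_eq prod.case by blast+
  have eigenvalues: "\<And>l. eigenvalue (\<rho> (h * h)) l \<Longrightarrow> l \<in> \<int>"
    and "diagonalizable (\<rho> (h * h))"
    using X unfolding category_C_def mem_Collect_eq prod.case power2_eq_square by blast+
  then obtain D P Q where D: "diagonal_mat D" and wit: "similar_mat_wit (\<rho> (h * h)) D P Q"
    unfolding diagonalizable_def similar_mat_def by blast
  note PQ = similar_mat_witD2[OF \<rho>(1) wit]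
  have "P * D * Q * P = P * D * (Q * P)"
    by (rule assoc_mult_mat) (use PQ(5-7) in auto)
  then have h2_P: "\<rho> (h * h) * P = P * D"
    unfolding PQ(3)[symmetric] PQ(2) using PQ(5,6) by simp
  define c where "c l = (\<lambda>y. \<xi> \<bullet> (\<rho> y *\<^sub>v col P l))" for l
  have col_P: "col P l \<in> carrier_vec n" for l
    using carrier_matD(1)[OF PQ(6)] by (intro carrier_vecI) simp
  have \<rho>_col: "\<rho> y *\<^sub>v col P l \<in> carrier_vec n" for y l
    using \<rho>(1) col_P by (rule mult_mat_vec_carrier)
  have eigen: "\<rho> (h * h) *\<^sub>v col P l = D $$ (l, l) \<cdot>\<^sub>v col P l" if "l < n" for l
    by (simp only: mult_mat_vec_col[OF \<rho>(1) PQ(6) that] h2_P col_diagonal[OF PQ(6,5) D that])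
  have integral: "D $$ (l, l) \<in> \<int>" if l: "l < n" for l
  proof -
    have "col P l \<noteq> 0\<^sub>v n"
    proof
      assume "col P l = 0\<^sub>v n"
      then have "Q *\<^sub>v col P l = 0\<^sub>v n" using PQ(7) by (simp, intro eq_vecI) auto
      moreover have "Q *\<^sub>v col P l = unit_vec n l"
        using l by (simp only: mult_mat_vec_col[OF PQ(7,6) l] PQ(2)) simp
      ultimately show False using l by simp
    qed
    then have "eigenvector (\<rho> (h * h)) (col P l) (D $$ (l, l))"
      using eigen[OF l] col_P[of l] \<rho>(1)[of "h * h"] by (simp add: eigenvector_def)
    then show ?thesis by (intro eigenvalues) (auto simp: eigenvalue_def)
  qed
  have sum_apply: "(\<Sum>l<N. F l y) = (\<Sum>l<N. F l) y" for F :: "nat \<Rightarrow> 'a \<Rightarrow> 'k" and N y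
    by (induction N) simp_all
  have "c l \<in> functionals.span integral_eigenfunctionals" if l: "l < n" for l
  proof (rule eigenfunctional_split[OF _ _ integral[OF l]])
    show "c l \<in> A_dual"
      using \<xi> col_P[of l] \<rho>(1)
      by (auto simp: linear_functionals_def c_def \<rho> add_mult_distrib_mat_vec[of _ n n]
          scalar_prod_add_distrib[OF \<xi> \<rho>_col \<rho>_col] scalar_prod_smult_distrib[OF \<xi> \<rho>_col]
          smult_mat_mult_vec[of _ n n])
    fix y
    have "c l (h * (h * y)) = \<xi> \<bullet> (\<rho> y *\<^sub>v (\<rho> (h * h) *\<^sub>v col P l))"
      unfolding h2_central[of y] 
      by (simp only: c_def \<rho>(3)[of y] assoc_mult_mat_vec[OF \<rho>(1) \<rho>(1) col_P])
    then show "c l (h * (h * y)) = D $$ (l, l) * c l y"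
      using \<xi> col_P[of l] \<rho>(1)[of y]
      by (simp add: c_def eigen[OF l] mult_mat_vec[of _ n n] scalar_prod_smult_distrib[OF \<xi> \<rho>_col])
  qed
  \<comment> \<open>The coordinates of \<open>v\<close> in the columns of \<open>P\<close> are the entries of \<open>Q v\<close>.\<close>
  then have "(\<Sum>l<n. dual_scale ((Q *\<^sub>v v) $ l) (c l)) \<in> functionals.span integral_eigenfunctionals"
    by (intro functionals.span_sum functionals.span_scale) simp
  also have "(\<Sum>l<n. dual_scale ((Q *\<^sub>v v) $ l) (c l)) = (\<lambda>y. \<xi> \<bullet> (\<rho> y *\<^sub>v v))"
  proof
    fix y
    have "P *\<^sub>v (Q *\<^sub>v v) = v"
      using v by (simp only: assoc_mult_mat_vec[OF PQ(6,7) v, symmetric] PQ(1)) simp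
    moreover have "(\<rho> y * P) *\<^sub>v (Q *\<^sub>v v) = \<rho> y *\<^sub>v (P *\<^sub>v (Q *\<^sub>v v))"
      using PQ(6,7) v by (intro assoc_mult_mat_vec[OF \<rho>(1)]) auto
    ultimately have "\<xi> \<bullet> (\<rho> y *\<^sub>v v) = \<xi> \<bullet> ((\<rho> y * P) *\<^sub>v (Q *\<^sub>v v))"
      by (simp only:)
    also have "\<dots> = (\<Sum>l<n. (Q *\<^sub>v v) $ l * (\<xi> \<bullet> col (\<rho> y * P) l))"
      by (rule scalar_prod_mult_mat_vec_columns) (use PQ(6,7) \<rho>(1)[of y] \<xi> v in auto)
    also have "\<dots> = (\<Sum>l<n. dual_scale ((Q *\<^sub>v v) $ l) (c l) y)"
      by (intro sum.cong refl)
        (simp only: mult_mat_vec_col[OF \<rho>(1) PQ(6)] c_def dual_scale_def lessThan_iff)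
    also have "\<dots> = (\<Sum>l<n. dual_scale ((Q *\<^sub>v v) $ l) (c l)) y"
      by (rule sum_apply)
    finally show "(\<Sum>l<n. dual_scale ((Q *\<^sub>v v) $ l) (c l)) y = \<xi> \<bullet> (\<rho> y *\<^sub>v v)" ..
  qed
  finally show ?thesis .
qed

lemma two_dim_rep_entry_reconstructed:
  assumes rep: "two_dim_rep s n R" and n: "n \<in> \<int>"
  shows "(\<lambda>y. R y i j) \<in> reconstructed scale h"
proof -
  note R = two_dim_repD[OF rep]
  define \<rho> where "\<rho> y = mat 2 2 (\<lambda>(i, j). R y (i = 1) (j = 1))" for y
  have bool_sum: "(\<Sum>k\<in>UNIV. F k) = F False + F True" for F :: "bool \<Rightarrow> 'k"
    by (simp add: UNIV_bool add.commute)
  have "left_module scale 2 \<rho>"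
    unfolding left_module_def
  proof (intro conjI allI)
    show "\<rho> 1 = 1\<^sub>m 2"
      by (rule eq_matI) (auto simp: \<rho>_def R matrix_one_def less_2_cases_iff)
    show "\<rho> (y * z) = \<rho> y * \<rho> z" for y z
      by (rule eq_matI) (simp_all add: \<rho>_def R matrix_mult_def bool_sum scalar_prod_def
          numeral_2_eq_2)
    show "\<rho> (y + z) = \<rho> y + \<rho> z" for y z by (rule eq_matI) (auto simp: \<rho>_def R)
    show "\<rho> (scale c y) = c \<cdot>\<^sub>m \<rho> y" for c y
      by (rule eq_matI) (auto simp: \<rho>_def R matrix_scale_def)
  qed (simp add: \<rho>_def)
  moreover have h2: "\<rho> (h\<^sup>2) = n \<cdot>\<^sub>m 1\<^sub>m 2"
    by (rule eq_matI)
      (auto simp: \<rho>_def power2_eq_square R matrix_mult_def bool_sum less_2_cases_iff)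
  moreover have "diagonalizable (n \<cdot>\<^sub>m 1\<^sub>m 2)"
    unfolding diagonalizable_def
    by (rule exI[of _ "n \<cdot>\<^sub>m 1\<^sub>m 2"]) (auto simp: diagonal_mat_def intro!: similar_mat_refl)
  moreover have "l \<in> \<int>" if "eigenvalue (n \<cdot>\<^sub>m 1\<^sub>m 2) l" for l
  proof -
    from that obtain w where w: "w \<in> carrier_vec 2" "w \<noteq> 0\<^sub>v 2" "(n \<cdot>\<^sub>m 1\<^sub>m 2) *\<^sub>v w = l \<cdot>\<^sub>v w"
      unfolding eigenvalue_def eigenvector_def by auto
    then have eq: "n \<cdot>\<^sub>v w = l \<cdot>\<^sub>v w" by (simp add: smult_mat_mult_vec[of _ 2 2])
    obtain i where i: "i < 2" "w $ i \<noteq> 0" using w(1,2) by (auto simp: vec_eq_iff)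
    then have "n * w $ i = l * w $ i" using arg_cong[OF eq, of "\<lambda>v. v $ i"] w(1) by simp
    with i n show ?thesis by simp
  qed
  ultimately have C: "(2, \<rho>) \<in> category_C scale h" by (simp add: category_C_def)
  define index :: "bool \<Rightarrow> nat" where "index b = (if b then 1 else 0)" for b
  have "R y i j = unit_vec 2 (index i) \<bullet> (\<rho> y *\<^sub>v unit_vec 2 (index j))" for y
    by (simp add: \<rho>_def scalar_prod_def index_def unit_vec_def numeral_2_eq_2)
  then have "(\<lambda>y. R y i j) \<in> cf (2, \<rho>)"
    unfolding cf_def prod.case
    by (intro functionals.span_base CollectI exI[of _ "unit_vec 2 (index i)"]
        exI[of _ "unit_vec 2 (index j)"]) auto
  then show ?thesis
    unfolding reconstructed_def using C by (blast intro: functionals.span_base)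
qed

theorem reconstructed_eq_span: "reconstructed scale h = functionals.span integral_eigenfunctionals"
proof
  have "cf X \<subseteq> functionals.span integral_eigenfunctionals" if "X \<in> category_C scale h" for X
  proof -
    obtain n \<rho> where X: "X = (n, \<rho>)" by (cases X)
    show ?thesis
      unfolding X cf_def prod.case
      using matrix_coefficient_in_span that X by (intro functionals.span_minimal) auto
  qed
  then show "reconstructed scale h \<subseteq> functionals.span integral_eigenfunctionals"
    unfolding reconstructed_def by (intro functionals.span_minimal) auto
next
  have "eigenfunctionals s n \<subseteq> reconstructed scale h" if s: "s * s = 1" and n: "n \<in> \<int>" for s n
  proof
    fix f assume f: "f \<in> eigenfunctionals s n"
    have s': "(- s) * (- s) = 1" using s by simp
    obtain R R' where R: "two_dim_rep s n R" and R': "two_dim_rep (- s) n R'"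
      using two_dim_rep_exists[OF s] two_dim_rep_exists[OF s'] by metis
    have "even_functional s n \<in> reconstructed scale h" "odd_functional s n \<in> reconstructed scale h"
      using two_dim_rep_entry_reconstructed[OF R n] two_dim_rep_entry_reconstructed[OF R' n]
      by (simp_all add: even_functional_entry[OF R] odd_functional_entry[OF R'])
    then show "f \<in> reconstructed scale h"
      unfolding reconstructed_def
      by (subst eigenfunctional_decompose[OF s f]) (intro functionals.span_add functionals.span_scale)
  qed
  then have "integral_eigenfunctionals \<subseteq> reconstructed scale h"
    unfolding integral_eigenfunctionals_def by (intro UN_least) (metis insertE minus_mult_minus mult_1 singletonD)
  then show "functionals.span integral_eigenfunctionals \<subseteq> reconstructed scale h"
    by (rule functionals.span_minimal) (simp add: reconstructed_def)
qed

lemma sign_cases: "s \<in> {1, - 1 :: 'k} \<Longrightarrow> s * s = 1"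
  by auto

lemma integral_eigenfunctionalsE:
  assumes "f \<in> integral_eigenfunctionals"
  obtains s n where "s \<in> {1, - 1}" "n \<in> \<int>" "f \<in> eigenfunctionals s n"
  using assms unfolding integral_eigenfunctionals_def by (elim UN_E) (rule that)

lemma reconstructed_basis:
  assumes "s \<in> {1, - 1}" "n \<in> \<int>"
  shows "even_functional s n \<in> reconstructed scale h" "odd_functional s n \<in> reconstructed scale h"
proof -
  have "eigenfunctionals s n \<subseteq> reconstructed scale h"
    using assms functionals.span_superset[of integral_eigenfunctionals]
    unfolding reconstructed_eq_span integral_eigenfunctionals_def by blast
  then show "even_functional s n \<in> reconstructed scale h" "odd_functional s n \<in> reconstructed scale h"
    using even_functional(1) odd_functional(1) sign_cases[OF assms(1)] by blast+
qed

lemma reconstructed_induct [consumes 1, case_names zero add scale even odd]: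
  assumes "f \<in> reconstructed scale h" and "P 0" "\<And>f e. P f \<Longrightarrow> P e \<Longrightarrow> P (f + e)"
    "\<And>c f. P f \<Longrightarrow> P (dual_scale c f)"
    and "\<And>s n. s \<in> {1, - 1} \<Longrightarrow> n \<in> \<int> \<Longrightarrow> P (even_functional s n)"
    and "\<And>s n. s \<in> {1, - 1} \<Longrightarrow> n \<in> \<int> \<Longrightarrow> P (odd_functional s n)"
  shows "P f"
proof -
  have eigen: "P f" if "f \<in> integral_eigenfunctionals" for f
  proof -
    obtain s n where s: "s \<in> {1, - 1}" and n: "n \<in> \<int>" and f: "f \<in> eigenfunctionals s n"
      using \<open>f \<in> integral_eigenfunctionals\<close> by (rule integral_eigenfunctionalsE)
    show ?thesis
      by (subst eigenfunctional_decompose[OF sign_cases[OF s] f]) (intro assms s n)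
  qed
  from assms(1) show ?thesis
    unfolding reconstructed_eq_span
  proof (induction rule: functionals.span_induct_alt)
    case (step c x y)
    show ?case using assms(3)[OF assms(4)[OF eigen[OF step(1)]] step(2)] .
  qed (rule assms(2))
qed

lemma subspace_reconstructed: "functionals.subspace (reconstructed scale h)"
  by (simp add: reconstructed_def)

lemma reconstructed_linear: "reconstructed scale h \<subseteq> A_dual"
  unfolding reconstructed_eq_span
  by (rule functionals.span_minimal[OF _ subspace_linear_functionals])
    (auto simp: integral_eigenfunctionals_def eigenfunctionals_def)

text \<open>
  Both inductions carry along that the running element is a linear functional, as the convolution
  is bilinear on linear functionals.
\<close>

lemma reconstructed_convolve:
  assumes "f \<in> reconstructed scale h" "e \<in> reconstructed scale h"
  shows "f \<diamondop> e \<in> reconstructed scale h"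
proof -
  let ?H = "reconstructed scale h"
  have eigen: "f \<diamondop> e \<in> ?H" if fe: "f \<in> integral_eigenfunctionals" "e \<in> integral_eigenfunctionals" for f e
  proof -
    obtain s m where s: "s \<in> {1, - 1}" and m: "m \<in> \<int>" and f: "f \<in> eigenfunctionals s m"
      using fe(1) by (rule integral_eigenfunctionalsE)
    obtain t n where t: "t \<in> {1, - 1}" and n: "n \<in> \<int>" and e: "e \<in> eigenfunctionals t n"
      using fe(2) by (rule integral_eigenfunctionalsE)
    have "s * t \<in> {1, - 1}" "m + n \<in> \<int>" using s t m n by auto
    then show ?thesis
      unfolding reconstructed_eq_span
      using convolve_eigenfunctionals(1)[OF sign_cases[OF s] f e]
      by (intro functionals.span_base) (auto simp: integral_eigenfunctionals_def)
  qed
  have closed: "c \<in> ?H \<Longrightarrow> d \<in> ?H \<Longrightarrow> dual_scale k c + d \<in> ?H" for c d k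
    by (simp add: subspace_reconstructed functionals.subspace_add functionals.subspace_scale)
  have dual: "f \<in> functionals.span integral_eigenfunctionals \<Longrightarrow> f \<in> A_dual" for f
    using reconstructed_linear reconstructed_eq_span by blast
  have zero: "0 \<in> ?H" "0 \<in> A_dual"
    by (simp_all add: functionals.subspace_0 subspace_reconstructed subspace_linear_functionals)
  have dual_closed: "dual_scale c x + y \<in> A_dual" if "x \<in> A_dual" "y \<in> A_dual" for c x y
    using that subspace_linear_functionals functionals.subspace_add functionals.subspace_scale by blast
  have right: "e \<in> A_dual \<and> f \<diamondop> e \<in> ?H" if f: "f \<in> integral_eigenfunctionals"
    and e: "e \<in> functionals.span integral_eigenfunctionals" for f e
    using e
  proof (induction rule: functionals.span_induct_alt)
    case base
    show ?case
      using full_dual.mult_zero(2)[OF dual[OF functionals.span_base[OF f]]] zero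
      by (simp add: zero_fun_def)
  next
    case (step c x y)
    have x: "f \<in> A_dual" "x \<in> A_dual" "y \<in> A_dual"
      using dual[OF functionals.span_base] f step by auto
    then have eq: "f \<diamondop> (dual_scale c x + y) = dual_scale c (f \<diamondop> x) + f \<diamondop> y"
      by (simp only: full_dual.mult_add_right full_dual.mult_scale_right
          functionals.subspace_scale[OF subspace_linear_functionals])
    show ?case
      unfolding eq
      using closed[OF eigen[OF f step(1)]] dual_closed[OF x(2,3)] step(2) by blast
  qed
  have e: "e \<in> functionals.span integral_eigenfunctionals"
    and "f \<in> functionals.span integral_eigenfunctionals"
    using assms reconstructed_eq_span by simp_all
  have left: "x \<diamondop> e \<in> ?H" if x: "x \<in> integral_eigenfunctionals" for x
    using right[OF x e] ..
  from \<open>f \<in> functionals.span integral_eigenfunctionals\<close> have "f \<in> A_dual \<and> f \<diamondop> e \<in> ?H"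
  proof (induction rule: functionals.span_induct_alt)
    case base
    show ?case using full_dual.mult_zero(1)[OF dual[OF e]] zero by (simp add: zero_fun_def)
  next
    case (step c x y)
    have x: "e \<in> A_dual" "x \<in> A_dual" "y \<in> A_dual"
      using dual[OF functionals.span_base] dual[OF e] step by auto
    then have eq: "(dual_scale c x + y) \<diamondop> e = dual_scale c (x \<diamondop> e) + y \<diamondop> e"
      by (simp only: full_dual.mult_add_left full_dual.mult_scale_left
          functionals.subspace_scale[OF subspace_linear_functionals])
    show ?case
      unfolding eq
      using closed[OF left[OF step(1)]] dual_closed[OF x(2,3)] step(2) by blast
  qed
  then show ?thesis ..
qed

lemma reconstructed_antipode:
  assumes "f \<in> reconstructed scale h"
  shows "dual_antipode S f \<in> reconstructed scale h"
  using assms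
proof (induction rule: reconstructed_induct)
  case zero
  then show ?case
    by (simp add: dual_antipode_def comp_def zero_fun_def[symmetric] functionals.subspace_0 subspace_reconstructed)
next
  case (add f e)
  then show ?case
    using functionals.subspace_add[OF subspace_reconstructed]
    by (simp add: dual_antipode_def comp_def plus_fun_def)
next
  case (scale c f)
  then show ?case
    using functionals.subspace_scale[OF subspace_reconstructed, of _ c]
    by (fastforce simp: dual_antipode_def comp_def dual_scale_def)
next
  case (even s n)
  then show ?case
    using reconstructed_basis[of s "- n"] by (simp add: antipode_basis(1)[OF sign_cases])
next
  case (odd s n)
  then have "odd_functional (- s) (- n) \<in> reconstructed scale h"
    by (intro reconstructed_basis) auto
  then show ?case
    using functionals.subspace_scale[OF subspace_reconstructed]
    by (simp only: antipode_basis(2)[OF sign_cases[OF odd(1)]])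
qed

lemma reconstructed_comult:
  assumes "f \<in> reconstructed scale h"
  shows "dual_comult (reconstructed scale h) f \<noteq> {}"
  using assms
proof (induction rule: reconstructed_induct)
  let ?H = "reconstructed scale h"
  note T = free_subspace_keys[of "?H \<times> ?H"]
  {
    case zero
    have "0 \<in> dual_comult ?H 0" by (simp add: dual_comult_def formal_tensors_def)
    then show ?case by blast
  next
    case (add f e)
    then obtain s t where "s \<in> dual_comult ?H f" "t \<in> dual_comult ?H e" by blast
    then have "s + t \<in> dual_comult ?H (f + e)"
      using free.subspace_add[OF T, of s t] by (simp add: dual_comult_def formal_tensors_def)
    then show ?case by blast
  next
    case (scale c f)
    then obtain t where "t \<in> dual_comult ?H f" by blast
    then have "free_scale c t \<in> dual_comult ?H (dual_scale c f)"
      using free.subspace_scale[OF T, of t c]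
      by (simp add: dual_comult_def formal_tensors_def dual_scale_def)
    then show ?case by blast
  next
    case (even s n)
    then show ?case
      using even_comult[OF sign_cases[OF even(1)] subspace_reconstructed]
        reconstructed_basis[of s n] reconstructed_basis[of "- s" n] by fastforce
  next
    case (odd s n)
    then show ?case
      using odd_comult[OF sign_cases[OF odd(1)]]
        reconstructed_basis[of s n] reconstructed_basis[of "- s" n] by fastforce
  }
qed

theorem hopf_algebra_reconstructed:
  "hopf_algebra dual_scale (reconstructed scale h) (\<diamondop>) \<epsilon> (dual_comult (reconstructed scale h))
     dual_counit (dual_antipode S)"
proof (rule hopf_algebra_of_functionals)
  show "\<epsilon> \<in> reconstructed scale h"
    unfolding counit_eq_even by (rule reconstructed_basis) auto
qed (auto intro: subspace_reconstructed reconstructed_linear[THEN subsetD] reconstructed_convolve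
    reconstructed_antipode dest: reconstructed_comult)

end

section \<open>Congruence modulo a two-sided ideal\<close>

definition ideal_cong :: "'r::ring_1 set \<Rightarrow> 'r \<Rightarrow> 'r \<Rightarrow> bool" where
  "ideal_cong I p q \<longleftrightarrow> p - q \<in> I"

lemma two_sided_ideal_generated: "two_sided_ideal (ideal_generated R)"
  unfolding ideal_generated_def two_sided_ideal_def by blast

lemma ideal_generated_superset: "R \<subseteq> ideal_generated R"
  unfolding ideal_generated_def by blast

context
  fixes I :: "'r::ring_1 set"
  assumes I: "two_sided_ideal I"
begin

lemma ideal_closed:
  "0 \<in> I" "p \<in> I \<Longrightarrow> q \<in> I \<Longrightarrow> p + q \<in> I" "p \<in> I \<Longrightarrow> r * p \<in> I" "p \<in> I \<Longrightarrow> p * r \<in> I"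
  using I unfolding two_sided_ideal_def by blast+

lemma ideal_uminus: "p \<in> I \<Longrightarrow> - p \<in> I"
  using ideal_closed(3)[of p "- 1"] by simp

lemma ideal_cong_refl: "ideal_cong I p p"
  by (simp add: ideal_cong_def ideal_closed)

lemma ideal_cong_sym: "ideal_cong I p q \<Longrightarrow> ideal_cong I q p"
  using ideal_uminus[of "p - q"] by (simp add: ideal_cong_def)

lemma ideal_cong_trans: "ideal_cong I p q \<Longrightarrow> ideal_cong I q r \<Longrightarrow> ideal_cong I p r"
  using ideal_closed(2)[of "p - q" "q - r"] by (simp add: ideal_cong_def)

lemma ideal_cong_add: "ideal_cong I p p' \<Longrightarrow> ideal_cong I q q' \<Longrightarrow> ideal_cong I (p + q) (p' + q')"
  using ideal_closed(2)[of "p - p'" "q - q'"] by (simp add: ideal_cong_def algebra_simps)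

lemma ideal_cong_mult:
  assumes "ideal_cong I p p'" "ideal_cong I q q'"
  shows "ideal_cong I (p * q) (p' * q')"
proof -
  have "(p - p') * q + p' * (q - q') \<in> I"
    using assms by (intro ideal_closed) (auto simp: ideal_cong_def)
  then show ?thesis by (simp add: ideal_cong_def algebra_simps)
qed

lemma ideal_cong_left: "ideal_cong I p p' \<Longrightarrow> ideal_cong I (p * q) (p' * q)"
  by (intro ideal_cong_mult ideal_cong_refl)

lemma ideal_cong_right: "ideal_cong I q q' \<Longrightarrow> ideal_cong I (p * q) (p * q')"
  by (intro ideal_cong_mult ideal_cong_refl)

text \<open>
  What commutes with a unit commutes with its inverse: \<open>y b = b a y b = b y a b = b y\<close>.
\<close>

lemma ideal_cong_commute_inverse:
  assumes "ideal_cong I (a * b) 1" "ideal_cong I (b * a) 1" "ideal_cong I (y * a) (a * y)"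
  shows "ideal_cong I (y * b) (b * y)"
proof -
  have "ideal_cong I (b * (y * a) * b) (b * (a * y) * b)"
    by (intro ideal_cong_left ideal_cong_right assms)
  moreover have "ideal_cong I (b * (y * a) * b) (b * y)"
    using ideal_cong_right[OF assms(1), of "b * y"] by (simp add: mult.assoc)
  moreover have "ideal_cong I (b * (a * y) * b) (y * b)"
    using ideal_cong_left[OF assms(2), of "y * b"] by (simp add: mult.assoc)
  ultimately show ?thesis by (meson ideal_cong_sym ideal_cong_trans)
qed

lemma ideal_cong_commute_power:
  assumes "ideal_cong I (y * a) (a * y)"
  shows "ideal_cong I (y * a ^ n) (a ^ n * y)"
proof (induction n)
  case (Suc n)
  have "ideal_cong I (y * a * a ^ n) (a * y * a ^ n)" by (intro ideal_cong_left assms)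
  moreover have "ideal_cong I (a * (y * a ^ n)) (a * (a ^ n * y))" by (intro ideal_cong_right Suc)
  ultimately show ?case by (simp add: mult.assoc) (rule ideal_cong_trans)
qed (simp add: ideal_cong_refl)

end

section \<open>Normal forms\<close>

type_synonym 'k free_H = "gen_H free_monoid \<Rightarrow>\<^sub>0 'k"

abbreviation I_H :: "'k::field free_H set" where
  "I_H \<equiv> ideal_generated relations_H"

text \<open>
  The power \<open>a\<^sup>n\<close> for an integer \<open>n\<close>, as an element of the free algebra.
\<close>

definition a_power :: "int \<Rightarrow> 'k::field free_H" where
  "a_power n = (if n \<ge> 0 then var Gen_a ^ nat n else var Gen_a_inv ^ nat (- n))"

definition normal_form :: "int \<Rightarrow> nat \<Rightarrow> nat \<Rightarrow> 'k::field free_H" where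
  "normal_form n e i = a_power n * var Gen_x ^ e * var Gen_u ^ i"

definition normal_forms :: "'k::field free_H set" where
  "normal_forms = {normal_form n e i | n e i. e < 2 \<and> i < 2}"

lemmas cong_H_rules = ideal_cong_refl[OF two_sided_ideal_generated]
  ideal_cong_left[OF two_sided_ideal_generated] ideal_cong_right[OF two_sided_ideal_generated]
lemmas cong_H_trans = ideal_cong_trans[OF two_sided_ideal_generated]

lemma relations_H_cong:
  "ideal_cong I_H (var Gen_u * var Gen_u) 1"
  "ideal_cong I_H (var Gen_x * var Gen_x) 0"
  "ideal_cong I_H (var Gen_u * var Gen_x) (- (var Gen_x * var Gen_u))"
  "ideal_cong I_H (var Gen_a * var Gen_a_inv) 1"
  "ideal_cong I_H (var Gen_a_inv * var Gen_a) 1"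
  "ideal_cong I_H (var Gen_u * var Gen_a) (var Gen_a * var Gen_u)"
  "ideal_cong I_H (var Gen_a * var Gen_x) (var Gen_x * var Gen_a)"
  using ideal_generated_superset[of relations_H]
  by (auto simp: ideal_cong_def relations_H_def power2_eq_square)

lemma a_power_left: "ideal_cong I_H (var Gen_a * a_power n :: 'k::field free_H) (a_power (n + 1))"
proof (cases "n \<ge> 0")
  case True
  then have "var Gen_a * a_power n = (a_power (n + 1) :: 'k free_H)"
    by (simp add: a_power_def nat_add_distrib)
  then show ?thesis by (simp add: cong_H_rules)
next
  case False
  then have n: "nat (- n) = Suc (nat (- n - 1))" by simp
  have "ideal_cong I_H (var Gen_a * var Gen_a_inv * var Gen_a_inv ^ nat (- n - 1) :: 'k free_H)
      (1 * var Gen_a_inv ^ nat (- n - 1))"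
    by (intro cong_H_rules relations_H_cong)
  moreover have "var Gen_a * a_power n = (var Gen_a :: 'k free_H) * var Gen_a_inv * var Gen_a_inv ^ nat (- n - 1)"
    using False by (simp only: a_power_def n power_Suc mult.assoc if_False)
  moreover have "a_power (n + 1) = (var Gen_a_inv :: 'k free_H) ^ nat (- n - 1)"
    using False by (cases "n = -1") (simp_all add: a_power_def)
  ultimately show ?thesis by simp
qed

lemma a_inv_power_left: "ideal_cong I_H (var Gen_a_inv * a_power n :: 'k::field free_H) (a_power (n - 1))"
proof (cases "n > 0")
  case False
  then have "nat (1 - n) = Suc (nat (- n))" by simp
  then have "var Gen_a_inv * a_power n = (a_power (n - 1) :: 'k free_H)"
    using False by (cases "n = 0") (simp_all add: a_power_def)
  then show ?thesis by (simp add: cong_H_rules)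
next
  case True
  then have n: "nat n = Suc (nat (n - 1))" by simp
  have "ideal_cong I_H (var Gen_a_inv * var Gen_a * var Gen_a ^ nat (n - 1) :: 'k free_H)
      (1 * var Gen_a ^ nat (n - 1))"
    by (intro cong_H_rules relations_H_cong)
  moreover have "var Gen_a_inv * a_power n = (var Gen_a_inv :: 'k free_H) * var Gen_a * var Gen_a ^ nat (n - 1)"
    using True by (simp add: a_power_def n mult.assoc)
  moreover have "a_power (n - 1) = (var Gen_a :: 'k free_H) ^ nat (n - 1)"
    using True by (simp add: a_power_def)
  ultimately show ?thesis by simp
qed

lemma a_power_commute:
  assumes "i = Gen_u \<or> i = Gen_x"
  shows "ideal_cong I_H (var i * a_power n :: 'k::field free_H) (a_power n * var i)"
proof -
  note J = two_sided_ideal_generated[of "relations_H :: 'k free_H set"]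
  have a: "ideal_cong I_H (var i * var Gen_a :: 'k free_H) (var Gen_a * var i)"
    using assms relations_H_cong(6) ideal_cong_sym[OF J relations_H_cong(7)] by auto
  have a': "ideal_cong I_H (var i * var Gen_a_inv :: 'k free_H) (var Gen_a_inv * var i)"
    by (rule ideal_cong_commute_inverse[OF J relations_H_cong(4,5) a])
  show ?thesis
    unfolding a_power_def using ideal_cong_commute_power[OF J a] ideal_cong_commute_power[OF J a']
    by simp
qed

text \<open>
  Multiplying a normal form \<open>a\<^sup>n x\<^sup>e u\<^sup>i\<close> from the left by \<open>a\<^sup>\<plusminus>\<^sup>1\<close> shifts \<open>n\<close>; a factor \<open>x\<close> or \<open>u\<close> moves past
  \<open>a\<^sup>n\<close> and is absorbed, with \<open>x\<^sup>2 = 0\<close>, \<open>u\<^sup>2 = 1\<close> and a sign when \<open>u\<close> passes \<open>x\<close>.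
\<close>

lemma var_times_normal_form:
  assumes "e < 2" "i < 2"
  shows "\<exists>w \<in> free.span normal_forms. ideal_cong I_H (var v * normal_form n e i :: 'k::field free_H) w"
proof -
  have nf: "(normal_form m e' i' :: 'k free_H) \<in> free.span normal_forms" if "e' < 2" "i' < 2" for m e' i'
    using that by (auto simp: normal_forms_def intro!: free.span_base)
  let ?p = "var v * normal_form n e i :: 'k free_H"
  let ?r = "var Gen_x ^ e * var Gen_u ^ i :: 'k free_H"
  show ?thesis
  proof (cases v)
    case Gen_a
    have "ideal_cong I_H ?p (normal_form (n + 1) e i)"
      using cong_H_rules(2)[OF a_power_left, of n ?r] by (simp add: normal_form_def mult.assoc Gen_a)
    then show ?thesis using nf assms by blast
  next
    case Gen_a_inv
    have "ideal_cong I_H ?p (normal_form (n - 1) e i)"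
      using cong_H_rules(2)[OF a_inv_power_left, of n ?r]
      by (simp add: normal_form_def mult.assoc Gen_a_inv)
    then show ?thesis using nf assms by blast
  next
    case Gen_x
    have step: "ideal_cong I_H ?p (a_power n * var Gen_x * ?r)"
      using cong_H_rules(2)[OF a_power_commute[of Gen_x n], of ?r]
      by (simp add: normal_form_def mult.assoc Gen_x)
    show ?thesis
    proof (cases "e = 0")
      case True
      then have "a_power n * var Gen_x * ?r = normal_form n 1 i"
        by (simp add: normal_form_def mult.assoc)
      with step show ?thesis using nf[of 1 i n] assms(2) by auto
    next
      case False
      with assms have "e = 1" by simp
      then have "ideal_cong I_H (a_power n * var Gen_x * ?r) 0"
        using cong_H_rules(3)[OF cong_H_rules(2)[OF relations_H_cong(2)], of "a_power n" "var Gen_u ^ i"]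
        by (simp add: mult.assoc)
      with step have "ideal_cong I_H ?p 0" by (rule cong_H_trans)
      then show ?thesis using free.span_zero by blast
    qed
  next
    case Gen_u
    have step: "ideal_cong I_H ?p (a_power n * var Gen_u * ?r)"
      using cong_H_rules(2)[OF a_power_commute[of Gen_u n], of ?r]
      by (simp add: normal_form_def mult.assoc Gen_u)
    have u_power: "ideal_cong I_H (var Gen_u * var Gen_u ^ i :: 'k free_H) (var Gen_u ^ (1 - i))"
    proof (cases "i = 0")
      case False
      with assms have "i = 1" by simp
      then show ?thesis using relations_H_cong(1) by simp
    qed (simp add: cong_H_rules)
    show ?thesis
    proof (cases "e = 0")
      case True
      then have "ideal_cong I_H (a_power n * var Gen_u * ?r) (normal_form n 0 (1 - i))"
        using cong_H_rules(3)[OF u_power, of "a_power n"]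
        by (simp add: normal_form_def mult.assoc)
      with step have "ideal_cong I_H ?p (normal_form n 0 (1 - i))"
        by (rule cong_H_trans)
      then show ?thesis using nf[of 0 "1 - i" n] by auto
    next
      case False
      with assms have e: "e = 1" by simp
      have "ideal_cong I_H (a_power n * (var Gen_u * var Gen_x * var Gen_u ^ i))
          (a_power n * (- (var Gen_x * var Gen_u) * var Gen_u ^ i) :: 'k free_H)"
        by (intro cong_H_rules relations_H_cong)
      moreover have "ideal_cong I_H (- (a_power n * var Gen_x) * (var Gen_u * var Gen_u ^ i))
          (- (a_power n * var Gen_x) * var Gen_u ^ (1 - i) :: 'k free_H)"
        by (intro cong_H_rules u_power)
      ultimately have "ideal_cong I_H (a_power n * var Gen_u * ?r) (- normal_form n 1 (1 - i))"
        by (simp add: normal_form_def mult.assoc e) (rule cong_H_trans)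
      with step have "ideal_cong I_H ?p (- normal_form n 1 (1 - i))"
        by (rule cong_H_trans)
      moreover have "- normal_form n 1 (1 - i) \<in> free.span (normal_forms :: 'k free_H set)"
        by (intro free.span_neg nf) auto
      ultimately show ?thesis by blast
    qed
  qed
qed

text \<open>
  The normal forms span the free algebra modulo the relations: their span contains \<open>1\<close> and is, modulo
  the relations, stable under left multiplication by the generators, hence contains all words.
\<close>

theorem normal_forms_span:
  fixes p :: "'k::field free_H"
  shows "\<exists>w \<in> free.span normal_forms. ideal_cong I_H p w"
proof -
  note J = two_sided_ideal_generated[of "relations_H :: 'k free_H set"]
  note cong_add = ideal_cong_add[OF J]
  have cong_scale: "ideal_cong I_H (free_scale c p) (free_scale c q)" if "ideal_cong I_H p q" for c and p q :: "'k free_H"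
    using cong_H_rules(3)[OF that, of "Poly_Mapping.single 0 c"]
    by (simp add: free_scale_def mult_map_scale_conv_mult)
  have left: "\<exists>w' \<in> free.span normal_forms. ideal_cong I_H (var v * w) w'"
    if "w \<in> free.span normal_forms" for v and w :: "'k free_H"
    using that
  proof (induction rule: free.span_induct_alt)
    case base
    show ?case using free.span_zero cong_H_rules(1) by (metis mult_zero_right)
  next
    case (step c b w)
    obtain w1 where w1: "w1 \<in> free.span normal_forms" "ideal_cong I_H (var v * b) w1"
      using step(1) var_times_normal_form unfolding normal_forms_def by blast
    obtain w2 where w2: "w2 \<in> free.span normal_forms" "ideal_cong I_H (var v * w) w2"
      using step(2) by blast
    have "ideal_cong I_H (var v * (free_scale c b + w)) (free_scale c w1 + w2)"
      using cong_add[OF cong_scale[OF w1(2), of c] w2(2)]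
      by (simp add: distrib_left free_scale_times_right)
    then show ?case using w1(1) w2(1) free.span_add free.span_scale by blast
  qed
  have word: "\<exists>w \<in> free.span normal_forms. ideal_cong I_H (Poly_Mapping.single (Word vs) 1 :: 'k free_H) w" for vs
  proof (induction vs)
    case Nil
    have "(normal_form 0 0 0 :: 'k free_H) \<in> free.span normal_forms"
      by (rule free.span_base) (force simp: normal_forms_def)
    moreover have "Poly_Mapping.single (Word []) 1 = (normal_form 0 0 0 :: 'k free_H)"
      by (simp add: normal_form_def a_power_def zero_free_monoid_def[symmetric])
    ultimately show ?case using cong_H_rules(1) by metis
  next
    case (Cons v vs)
    then obtain w where w: "w \<in> free.span normal_forms"
      "ideal_cong I_H (Poly_Mapping.single (Word vs) 1 :: 'k free_H) w" by blast
    then obtain w' where w': "w' \<in> free.span normal_forms" "ideal_cong I_H (var v * w) w'"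
      using left by blast
    have "Poly_Mapping.single (Word (v # vs)) 1 = (var v :: 'k free_H) * Poly_Mapping.single (Word vs) 1"
      by (simp add: var_def mult_single plus_free_monoid_def)
    then show ?case using cong_H_trans[OF cong_H_rules(3)[OF w(2)] w'(2)] w'(1) by metis
  qed
  show ?thesis
  proof (induction p rule: linear_ext_induct)
    case zero
    show ?case using free.span_zero cong_H_rules(1) by blast
  next
    case (add s t)
    then show ?case using cong_add free.span_add by meson
  next
    case (scale c t)
    then show ?case using cong_scale free.span_scale by meson
  next
    case (single i)
    show ?case using word[of "letters i"] by simp
  qed
qed

section \<open>The presentation of H\<close>

context hopf_A
begin

definition basis_functional :: "nat \<Rightarrow> 'k \<Rightarrow> 'k \<Rightarrow> ('a \<Rightarrow> 'k)" where
  "basis_functional e s n = (if e = 0 then even_functional s n else odd_functional s n)"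

lemma basis_functional:
  assumes "s * s = 1"
  shows "basis_functional e s n \<in> eigenfunctionals s n"
    "basis_functional e s n 1 = of_bool (e = 0)" "basis_functional e s n h = of_bool (e \<noteq> 0)"
  using even_functional[OF assms] odd_functional[OF assms] by (simp_all add: basis_functional_def)

text \<open>
  Polynomials in \<open>h\<^sup>2\<close> act on eigenfunctionals by their value at the eigenvalue \<open>n\<close>.
\<close>

lemma h2_polynomial:
  assumes "finite M"
  shows "\<exists>Y. \<forall>s n f z. f \<in> eigenfunctionals s n \<longrightarrow> f (Y * z) = (\<Prod>m\<in>M. n - m) * f z"
  using assms
proof (induction M)
  case empty
  show ?case by (rule exI[of _ 1]) simp
next
  case (insert m M)
  then obtain Y where Y: "\<And>s n f z. f \<in> eigenfunctionals s n \<Longrightarrow> f (Y * z) = (\<Prod>m\<in>M. n - m) * f z"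
    by blast
  have "f ((h * h - scale m 1) * Y * z) = (\<Prod>m\<in>insert m M. n - m) * f z"
    if f: "f \<in> eigenfunctionals s n" for s n f z
  proof -
    note f' = eigenfunctionalsD[OF f]
    have "f ((h * h - scale m 1) * Y * z) = f (h * (h * (Y * z)) + - scale m (Y * z))"
      by (simp add: left_diff_distrib mult.assoc mult_scale_left)
    also have "\<dots> = n * f (Y * z) - m * f (Y * z)"
      by (simp only: linear_functionalsD[OF f'(1)] linear_functional_minus[OF f'(1)] f'(3)) simp
    also have "\<dots> = (\<Prod>m\<in>insert m M. n - m) * f z"
      using insert by (simp add: Y[OF f] algebra_simps)
    finally show ?thesis .
  qed
  then show ?case by blast
qed

text \<open>
  A multiple of \<open>\<Prod>(h\<^sup>2 - m) (1 + \<sigma> g) h\<^sup>e\<close>, the product over the \<open>m \<in> M\<close> other than \<open>n\<close>, is dual to one basis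
  functional; the normalising factor is twice the value of the product at \<open>n\<close>.
\<close>

lemma separating_element:
  assumes M: "finite M" and \<sigma>: "\<sigma> \<in> {1, - 1}" and e: "e < 2"
  shows "\<exists>y. \<forall>e' s n'. e' < 2 \<longrightarrow> s \<in> {1, - 1} \<longrightarrow> n' \<in> M \<longrightarrow>
    basis_functional e' s n' y = of_bool (e' = e \<and> s = \<sigma> \<and> n' = n)"
proof -
  obtain Y where Y: "\<And>s n' f z. f \<in> eigenfunctionals s n' \<Longrightarrow>
      f (Y * z) = (\<Prod>m\<in>M - {n}. n' - m) * f z"
    using h2_polynomial[of "M - {n}"] M by blast
  define c where "c = 2 * (\<Prod>m\<in>M - {n}. n - m)"
  have "c \<noteq> 0" using M by (simp add: c_def)
  define he where "he = (if e = 0 then 1 else h)"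
  define y where "y = scale (1 / c) (Y * (he + scale \<sigma> (g * he)))"
  have "basis_functional e' s n' y = of_bool (e' = e \<and> s = \<sigma> \<and> n' = n)"
    if e': "e' < 2" and s: "s \<in> {1, - 1}" and n': "n' \<in> M" for e' s n'
  proof -
    note b = basis_functional[OF sign_cases[OF s], of e' n']
    note b' = eigenfunctionalsD[OF b(1)]
    have "basis_functional e' s n' he = of_bool (e' = e)"
      using e e' by (auto simp: he_def b)
    then have y_value: "basis_functional e' s n' y
        = 1 / c * ((\<Prod>m\<in>M - {n}. n' - m) * ((1 + \<sigma> * s) * of_bool (e' = e)))"
      by (simp only: y_def linear_functionalsD[OF b'(1)] Y[OF b(1)] b'(2)) (simp add: algebra_simps)
    show ?thesis
    proof (cases "n' = n")
      case True
      then show ?thesis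
        using s \<sigma> \<open>c \<noteq> 0\<close> unfolding y_value by (auto simp: c_def)
    next
      case False
      then have "(\<Prod>m\<in>M - {n}. n' - m) = 0" using M n' by auto
      then show ?thesis using False unfolding y_value by simp
    qed
  qed
  then show ?thesis by blast
qed

abbreviation H_gen :: "gen_H \<Rightarrow> ('a \<Rightarrow> 'k)" where
  "H_gen \<equiv> case_gen_H (even_functional (- 1) 0) (odd_functional (- 1) 0)
     (even_functional 1 1) (even_functional 1 (- 1))"

abbreviation H_eval :: "(gen_H free_monoid \<Rightarrow>\<^sub>0 'k) \<Rightarrow> ('a \<Rightarrow> 'k)" where
  "H_eval \<equiv> eval_free dual_scale (\<diamondop>) \<epsilon> H_gen"

interpretation H: algebra_on dual_scale "reconstructed scale h" "(\<diamondop>)" \<epsilon>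
proof (rule algebra_on_functionals)
  show "\<epsilon> \<in> reconstructed scale h"
    unfolding counit_eq_even by (rule reconstructed_basis) auto
qed (auto intro: subspace_reconstructed reconstructed_linear[THEN subsetD] reconstructed_convolve)

lemma H_gen_closed: "range H_gen \<subseteq> reconstructed scale h"
proof safe
  fix v show "H_gen v \<in> reconstructed scale h"
    by (cases v) (auto intro!: reconstructed_basis)
qed

lemmas H_eval_simps = H.eval_free_simps[OF H_gen_closed]

lemma H_eval_relations:
  assumes "r \<in> relations_H"
  shows "H_eval r = 0"
  using assms unfolding relations_H_def
  by (elim insertE emptyE; hypsubst; simp only: H_eval_simps power2_eq_square gen_H.case)
    (simp_all add: convolve_basis counit_eq_even)

lemma H_eval_a_power: "H_eval (a_power n) = even_functional 1 (of_int n)"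
proof -
  have a: "H_eval (var Gen_a ^ k) = even_functional 1 (of_nat k)" for k
    by (induction k)
      (simp_all only: H_eval_simps(1-7) power_0 power_Suc gen_H.case,
        simp_all add: convolve_basis counit_eq_even)
  have a': "H_eval (var Gen_a_inv ^ k) = even_functional 1 (- of_nat k)" for k
    by (induction k)
      (simp_all only: H_eval_simps(1-7) power_0 power_Suc gen_H.case,
        simp_all add: convolve_basis counit_eq_even)
  show ?thesis by (simp add: a_power_def a a')
qed

lemma H_eval_normal_form:
  assumes "e < 2" "i < 2"
  shows "H_eval (normal_form n e i) = basis_functional e ((- 1) ^ (e + i)) (of_int n)"
proof -
  have "e = 0 \<or> e = 1" "i = 0 \<or> i = 1" using assms by auto
  then show ?thesis
    by (elim disjE; simp only: normal_form_def H_eval_simps(1-7) power_0 power_one_right gen_H.case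
        mult_1_right H_eval_a_power)
      (simp_all add: convolve_basis basis_functional_def)
qed

lemma H_eval_onto: "range H_eval = reconstructed scale h"
proof
  show "range H_eval \<subseteq> reconstructed scale h"
    using H.eval_free_closed[OF H_gen_closed] by blast
  have "f \<in> range H_eval" if "f \<in> reconstructed scale h" for f
    using that
  proof (induction rule: reconstructed_induct)
    case zero
    show ?case by (rule range_eqI[of _ _ 0]) (simp add: H_eval_simps zero_fun_def)
  next
    case (add f e)
    then obtain p q where "f = H_eval p" "e = H_eval q" by blast
    then show ?case by (intro range_eqI[of _ _ "p + q"]) (simp add: H_eval_simps)
  next
    case (scale c f)
    then obtain p where "f = H_eval p" by blast
    then show ?case by (intro range_eqI[of _ _ "free_scale c p"]) (simp add: H_eval_simps)
  next
    case (even s n)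
    then obtain m where n: "n = of_int m" by (auto elim: Ints_cases)
    have "even_functional s n = H_eval (normal_form m 0 (if s = 1 then 0 else 1))"
      using even(1) by (auto simp: H_eval_normal_form basis_functional_def n)
    then show ?case by blast
  next
    case (odd s n)
    then obtain m where n: "n = of_int m" by (auto elim: Ints_cases)
    have "odd_functional s n = H_eval (normal_form m 1 (if s = 1 then 1 else 0))"
      using odd(1) by (auto simp: H_eval_normal_form basis_functional_def n)
    then show ?case by blast
  qed
  then show "reconstructed scale h \<subseteq> range H_eval" by blast
qed

text \<open>
  The exponents \<open>n\<close>, \<open>e\<close> and the sign \<open>(-1)\<close> to the power \<open>e + i\<close> determine a normal form, so different normal forms
  have different basis functionals as values, because in characteristic \<open>0\<close> neither signs nor integers
  are identified, and separating elements isolate each coefficient.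
\<close>

lemma H_eval_independent:
  assumes w: "w \<in> free.span normal_forms" and zero: "H_eval w = 0"
  shows "w = 0"
proof -
  obtain T r where T: "finite T" "T \<subseteq> normal_forms" and w_sum: "w = (\<Sum>b\<in>T. free_scale (r b) b)"
    using w unfolding free.span_explicit by blast
  have H_eval_sum: "H_eval w y = (\<Sum>b\<in>T. r b * H_eval b y)" for y
  proof -
    have "H_eval (\<Sum>b\<in>T. free_scale (r b) b) y = (\<Sum>b\<in>T. r b * H_eval b y)" if "finite T" for T
      using that
    proof (induction T)
      case (insert b T)
      then show ?case by (simp add: H_eval_simps) (simp add: dual_scale_def)
    qed (simp add: H_eval_simps)
    then show ?thesis using T(1) w_sum by simp
  qed
  have params: "\<exists>n e i. b = normal_form n e i \<and> e < 2 \<and> i < 2" if "b \<in> T" for b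
    using T(2) that unfolding normal_forms_def by blast
  then obtain N E J where NEJ: "\<And>b. b \<in> T \<Longrightarrow> b = normal_form (N b) (E b) (J b) \<and> E b < 2 \<and> J b < (2::nat)"
    by metis
  define sgn where "sgn b = ((- 1) ^ (E b + J b) :: 'k)" for b
  have sgn: "sgn b \<in> {1, - 1}" for b
    by (simp add: sgn_def) (metis neg_one_even_power neg_one_odd_power)
  have H_eval_b: "H_eval b = basis_functional (E b) (sgn b) (of_int (N b))" if "b \<in> T" for b
    using NEJ[OF that] H_eval_normal_form[of "E b" "J b" "N b"] by (simp add: sgn_def)
  have "r b = 0" if b: "b \<in> T" for b
  proof -
    obtain y where y: "\<And>e' s n'. e' < 2 \<Longrightarrow> s \<in> {1, - 1} \<Longrightarrow> n' \<in> (of_int \<circ> N) ` T \<Longrightarrow>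
        basis_functional e' s n' y = of_bool (e' = E b \<and> s = sgn b \<and> n' = of_int (N b))"
      using separating_element[OF finite_imageI[OF T(1)] sgn, of "E b" "of_int \<circ> N" b "of_int (N b)"] NEJ[OF b] by blast
    have "H_eval b' y = of_bool (b' = b)" if b': "b' \<in> T" for b'
    proof -
      have "b' = b" if "E b' = E b" "sgn b' = sgn b" "N b' = N b"
      proof -
        have "even (E b + J b') \<longleftrightarrow> even (E b + J b)"
          using that(1,2) by (auto simp: sgn_def minus_one_power_iff split: if_splits)
        then have "J b' = J b" using NEJ[OF b] NEJ[OF b'] by (auto simp: less_2_cases_iff)
        then show ?thesis using NEJ[OF b] NEJ[OF b'] that by metis
      qed
      then show ?thesis
        using y[of "E b'" "sgn b'" "of_int (N b')"] NEJ[OF b'] sgn b' H_eval_b[OF b'] by auto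
    qed
    then have "H_eval w y = (\<Sum>b'\<in>T. r b' * of_bool (b' = b))"
      by (simp add: H_eval_sum)
    also have "\<dots> = r b" using T(1) b by (simp add: sum_mult_of_bool_eq)
    finally show ?thesis using zero by simp
  qed
  then show ?thesis by (simp add: w_sum)
qed

theorem presentation_H:
  "presented_by dual_scale (reconstructed scale h) (\<diamondop>) \<epsilon> H_gen relations_H"
  unfolding presented_by_def
proof (intro conjI H_gen_closed H_eval_onto subset_antisym)
  show kernel: "I_H \<subseteq> {p. H_eval p = 0}"
    by (rule H.ideal_generated_subset_eval_kernel[OF H_gen_closed H_eval_relations])
  show "{p. H_eval p = 0} \<subseteq> I_H"
  proof safe
    fix p assume p: "H_eval p = 0"
    obtain w where w: "w \<in> free.span normal_forms" "p - w \<in> I_H"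
      using normal_forms_span[of p] unfolding ideal_cong_def by blast
    then have "H_eval (p - w) = 0" using kernel by blast
    then have "H_eval w = 0" using p by (simp add: H_eval_simps)
    then have "w = 0" using w(1) H_eval_independent by blast
    then show "p \<in> I_H" using w(2) by simp
  qed
qed

end

theorem proposition3p2:
  fixes scale :: "'k::field_char_0 \<Rightarrow> 'a::ring_1 \<Rightarrow> 'a"
    and \<Delta> :: "'a \<Rightarrow> ('a \<times> 'a \<Rightarrow>\<^sub>0 'k) set"
    and \<epsilon> :: "'a \<Rightarrow> 'k"
    and S :: "'a \<Rightarrow> 'a"
    and g h :: 'a
    and H :: "('a \<Rightarrow> 'k) set"
    and mult_H :: "('a \<Rightarrow> 'k) \<Rightarrow> ('a \<Rightarrow> 'k) \<Rightarrow> ('a \<Rightarrow> 'k)"  (infixl \<open>\<star>\<close> 70)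
  assumes hopf_A: "hopf_algebra scale UNIV (*) 1 \<Delta> \<epsilon> S"
    and presentation_A: "presented_by scale UNIV (*) 1 (case_gen_A g h) relations_A"
    and comult_g: "\<Delta> g = tensor_class scale UNIV (g \<otimes>\<^sub>f g)"
    and comult_h: "\<Delta> h = tensor_class scale UNIV ((g \<otimes>\<^sub>f h) + (h \<otimes>\<^sub>f 1))"
  defines "H \<equiv> reconstructed scale h"
    and "mult_H \<equiv> dual_mult \<Delta>"
  shows "hopf_algebra dual_scale H (\<star>) (dual_one \<epsilon>) (dual_comult H) dual_counit (dual_antipode S) \<and>
    (\<exists>u x a a'.
      presented_by dual_scale H (\<star>) (dual_one \<epsilon>) (case_gen_H u x a a') relations_H \<and>
      dual_comult H u = tensor_class dual_scale H (u \<otimes>\<^sub>f u) \<and>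
      dual_comult H x = tensor_class dual_scale H ((u \<otimes>\<^sub>f x) + (x \<otimes>\<^sub>f dual_one \<epsilon>)) \<and>
      dual_comult H a = tensor_class dual_scale H ((a \<otimes>\<^sub>f a) + ((x \<star> u \<star> a) \<otimes>\<^sub>f (x \<star> a))) \<and>
      dual_comult H a' = tensor_class dual_scale H ((a' \<otimes>\<^sub>f a') - ((x \<star> u \<star> a') \<otimes>\<^sub>f (x \<star> a'))) \<and>
      dual_counit u = 1 \<and> dual_counit x = 0 \<and> dual_counit a = 1 \<and> dual_counit a' = 1 \<and>
      dual_antipode S u = u \<and> dual_antipode S x = x \<star> u \<and>
      dual_antipode S a = a' \<and> dual_antipode S a' = a)"
proof -
  interpret A: hopf_A scale \<Delta> \<epsilon> S g h
    unfolding hopf_A_def hopf_ring_def hopf_A_axioms_def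
    using hopf_A presentation_A comult_g comult_h by blast
  define u where "u = A.even_functional (- 1) 0"
  define x where "x = A.odd_functional (- 1) 0"
  define a where "a = A.even_functional 1 1"
  define a' where "a' = A.even_functional 1 (- 1)"
  have mult: "mult_H = dual_mult \<Delta>" and one: "dual_one \<epsilon> = A.even_functional 1 0"
    by (simp_all add: mult_H_def dual_one_def A.counit_eq_even)
  have mem: "A.even_functional s n \<in> H" "A.odd_functional s n \<in> H" if "s \<in> {1, - 1}" "n \<in> \<int>" for s n
    unfolding H_def using A.reconstructed_basis[OF that] .
  have pure: "f \<otimes>\<^sub>f e \<in> {t :: ('a \<Rightarrow> 'k) \<times> ('a \<Rightarrow> 'k) \<Rightarrow>\<^sub>0 'k. Poly_Mapping.keys t \<subseteq> H \<times> H}"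
    if "f \<in> H" "e \<in> H" for f e
    using that by (simp add: pure_tensor_def)
  have comultI: "dual_comult H f = tensor_class dual_scale H t"
    if "t \<in> {t. Poly_Mapping.keys t \<subseteq> H \<times> H}"
      "\<And>y z. linear_ext (*) (\<lambda>(f1, f2). f1 y * f2 z) t = f (y * z)" for f t
    by (rule dual_comult_eq_tensor_class)
      (use that in \<open>simp_all add: H_def A.subspace_reconstructed dual_comult_def formal_tensors_def\<close>)
  note add = free.subspace_add[OF free_subspace_keys] and diff = free.subspace_diff[OF free_subspace_keys]
  have xu: "x \<star> u = A.odd_functional 1 0" and xua: "x \<star> u \<star> a = A.odd_functional 1 1"
    and xua': "x \<star> u \<star> a' = A.odd_functional 1 (- 1)"
    and xa: "x \<star> a = A.odd_functional (- 1) 1" and xa': "x \<star> a' = A.odd_functional (- 1) (- 1)"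
    by (simp_all add: mult u_def x_def a_def a'_def A.convolve_basis)
  have "hopf_algebra dual_scale H (\<star>) (dual_one \<epsilon>) (dual_comult H) dual_counit (dual_antipode S)"
    unfolding H_def mult dual_one_def by (rule A.hopf_algebra_reconstructed)
  moreover have "presented_by dual_scale H (\<star>) (dual_one \<epsilon>) (case_gen_H u x a a') relations_H"
    unfolding H_def mult dual_one_def u_def x_def a_def a'_def by (rule A.presentation_H)
  moreover have "dual_comult H u = tensor_class dual_scale H (u \<otimes>\<^sub>f u)"
    by (rule comultI) (auto intro!: pure mem simp: u_def pure_tensor_def A.even_functional_mult)
  moreover have "dual_comult H x = tensor_class dual_scale H ((u \<otimes>\<^sub>f x) + (x \<otimes>\<^sub>f dual_one \<epsilon>))"
    unfolding one u_def x_def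
    by (rule comultI[OF add[OF pure pure]])
      (auto intro!: mem simp: pure_tensor_def A.odd_functional_mult)
  moreover have "dual_comult H a = tensor_class dual_scale H ((a \<otimes>\<^sub>f a) + ((x \<star> u \<star> a) \<otimes>\<^sub>f (x \<star> a)))"
    unfolding xua xa unfolding a_def
    by (rule comultI[OF add[OF pure pure]])
      (auto intro!: mem simp: pure_tensor_def A.even_functional_mult)
  moreover have "dual_comult H a' = tensor_class dual_scale H ((a' \<otimes>\<^sub>f a') - ((x \<star> u \<star> a') \<otimes>\<^sub>f (x \<star> a')))"
    unfolding xua' xa' unfolding a'_def
    by (rule comultI[OF diff[OF pure pure]])
      (auto intro!: mem simp: pure_tensor_def A.even_functional_mult)
  moreover have "dual_counit u = 1" "dual_counit x = 0" "dual_counit a = 1" "dual_counit a' = 1"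
    by (simp_all add: dual_counit_def u_def x_def a_def a'_def A.even_functional A.odd_functional)
  moreover have "dual_antipode S u = u" "dual_antipode S x = x \<star> u"
    "dual_antipode S a = a'" "dual_antipode S a' = a"
    unfolding xu by (simp_all add: u_def x_def a_def a'_def A.antipode_basis)
  ultimately show ?thesis by blast
qed

end
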